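(* Let $\mathcal{X}_0=\{1,\dots,d_0\}$ with $d_0>1$, let $\mathcal{X}_{\mathrm{in}}$ be a finite totally ordered set, let $G$ be a graph on $\mathcal{X}_{\mathrm{in}}$, and let $\mathbb{K}$ be a field. Then the set of binomials $$\mathcal{G}=\Big\{\,u_\pi^\kappa\, f_{xy}^{\kappa(r)\kappa(0)} \;:\; x<y \text{ in } \mathcal{X}_{\mathrm{in}},\ \pi: x=x_0,x_1,\dots,x_r=y \text{ is an admissible path in } G \text{ from } x \text{ to } y,\ \kappa:\{0,\dots,r\}\to\mathcal{X}_0 \text{ is strictly } \pi\text{-antitone}\Big\}$$ is a reduced Gröbner basis of the binomial edge ideal $I_G\subseteq \mathbb{K}[p_{ix}: i\in\mathcal{X}_0, x\in\mathcal{X}_{\mathrm{in}}]$ with respect to the lexicographic monomial order induced by the following order of the unknowns: $p_{ix}>p_{jy}$ if and only if either $i>j$, or $i=j$ and $x>y$.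
   Context: Graphs are finite, undirected, and edges join distinct vertices; "a graph on $\mathcal{X}_{\mathrm{in}}$" has vertex set $\mathcal{X}_{\mathrm{in}}$. A path in $G$ is a sequence of vertices $x_0,x_1,\dots,x_r$ in which consecutive vertices are joined by an edge of $G$. Let $\mathfrak{R}=\mathbb{K}[p_{ix}: i\in\mathcal{X}_0, x\in\mathcal{X}_{\mathrm{in}}]$. For $i,j\in\mathcal{X}_0$ and $x,y\in\mathcal{X}_{\mathrm{in}}$ let $f^{ij}_{xy}=p_{ix}p_{jy}-p_{iy}p_{jx}$. The ($d_0$th) binomial edge ideal $I_G$ is the ideal of $\mathfrak{R}$ generated by all $f^{ij}_{xy}$ with $i,j\in\mathcal{X}_0$ and $(x,y)$ an edge of $G$. A path $\pi: x=x_0,x_1,\dots,x_r=y$ from $x$ to $y$ in $G$ is admissible if: (i) $x_s\neq x_t$ for $s\neq t$, and $x<y$; (ii) for each $k=1,\dots,r-1$, either $x_k<x$ or $x_k>y$; (iii) for any proper subset $\{y_1,\dots,y_s\}$ of $\{x_1,\dots,x_{r-1}\}$, the sequence $x,y_1,\dots,y_s,y$ is not a path in $G$. A function $\kappa:\{0,\dots,r\}\to\mathcal{X}_0$ is $\pi$-antitone if for all $0\le s,t\le r$: $x_s<x_t$ implies $\kappa(s)\ge\kappa(t)$. It is strictly $\pi$-antitone if it is $\pi$-antitone and $\kappa(0)>\kappa(r)$. For a path $\pi: x_0,\dots,x_r$ and a function $\kappa:\{0,\dots,r\}\to\mathcal{X}_0$, set $u_\pi^\kappa=\prod_{k=1}^{r-1}p_{\kappa(k)x_k}$.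 *)

theory Defs
  imports "HOL-Library.Poly_Mapping" "HOL-Library.FuncSet" "HOL-Algebra.Ideal"
begin

section \<open>Polynomials and Groebner bases\<close>

text \<open>
  A monomial is its finitely supported exponent function; a polynomial is a finitely supported
  function from monomials to coefficients, with the multiplication of \<^theory>\<open>HOL-Library.Poly_Mapping\<close>.
\<close>

type_synonym 'v monomial = "'v \<Rightarrow>\<^sub>0 nat"
type_synonym ('v, 'k) mpoly = "'v monomial \<Rightarrow>\<^sub>0 'k"

text \<open>The ring of polynomials in the unknowns \<open>V\<close> only.\<close>

definition poly_ring :: "'v set \<Rightarrow> ('v, 'k::field) mpoly ring" where
  "poly_ring V =
     \<lparr>carrier = {f. \<forall>m \<in> Poly_Mapping.keys f. Poly_Mapping.keys m \<subseteq> V},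
      mult = (*), one = 1, zero = 0, add = (+)\<rparr>"

definition var :: "'v \<Rightarrow> ('v, 'k::field) mpoly" where
  "var v = Poly_Mapping.single (Poly_Mapping.single v 1) 1"

text \<open>
  The lexicographic order on monomials induced by a strict order \<open>vless\<close> of the unknowns:
  the largest unknown whose exponents differ decides.
\<close>

definition lex_less :: "('v \<Rightarrow> 'v \<Rightarrow> bool) \<Rightarrow> 'v monomial \<Rightarrow> 'v monomial \<Rightarrow> bool" where
  "lex_less vless m n \<longleftrightarrow>
     (\<exists>v. Poly_Mapping.lookup m v < Poly_Mapping.lookup n v \<and>
          (\<forall>w. vless v w \<longrightarrow> Poly_Mapping.lookup m w = Poly_Mapping.lookup n w))"

text \<open>
  In the following, \<open>mless\<close> is a strict total order on monomials; leading data are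
  meaningful for nonzero polynomials only.
\<close>

definition leading_monomial ::
    "('v monomial \<Rightarrow> 'v monomial \<Rightarrow> bool) \<Rightarrow> ('v, 'k::field) mpoly \<Rightarrow> 'v monomial" where
  "leading_monomial mless f =
     (THE m. m \<in> Poly_Mapping.keys f \<and> (\<forall>n \<in> Poly_Mapping.keys f. n \<noteq> m \<longrightarrow> mless n m))"

definition leading_coeff ::
    "('v monomial \<Rightarrow> 'v monomial \<Rightarrow> bool) \<Rightarrow> ('v, 'k::field) mpoly \<Rightarrow> 'k" where
  "leading_coeff mless f = Poly_Mapping.lookup f (leading_monomial mless f)"

definition leading_term ::
    "('v monomial \<Rightarrow> 'v monomial \<Rightarrow> bool) \<Rightarrow> ('v, 'k::field) mpoly \<Rightarrow> ('v, 'k) mpoly" where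
  "leading_term mless f = Poly_Mapping.single (leading_monomial mless f) (leading_coeff mless f)"

definition monomial_dvd :: "'v monomial \<Rightarrow> 'v monomial \<Rightarrow> bool" where
  "monomial_dvd m n \<longleftrightarrow> (\<exists>k. n = m + k)"

definition groebner_basis ::
    "'v set \<Rightarrow> ('v monomial \<Rightarrow> 'v monomial \<Rightarrow> bool) \<Rightarrow>
     ('v, 'k::field) mpoly set \<Rightarrow> ('v, 'k) mpoly set \<Rightarrow> bool" where
  "groebner_basis V mless I G \<longleftrightarrow>
     ideal I (poly_ring V) \<and> finite G \<and> G \<subseteq> I \<and> 0 \<notin> G \<and>
     Idl\<^bsub>poly_ring V\<^esub> (leading_term mless ` G) =
     Idl\<^bsub>poly_ring V\<^esub> (leading_term mless ` (I - {0}))"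

definition reduced_groebner_basis ::
    "'v set \<Rightarrow> ('v monomial \<Rightarrow> 'v monomial \<Rightarrow> bool) \<Rightarrow>
     ('v, 'k::field) mpoly set \<Rightarrow> ('v, 'k) mpoly set \<Rightarrow> bool" where
  "reduced_groebner_basis V mless I G \<longleftrightarrow>
     groebner_basis V mless I G \<and>
     (\<forall>g \<in> G. leading_coeff mless g = 1) \<and>
     (\<forall>g \<in> G. \<forall>h \<in> G - {g}. \<forall>m \<in> Poly_Mapping.keys h.
        \<not> monomial_dvd (leading_monomial mless g) m)"


section \<open>Graphs and admissible paths\<close>

text \<open>A graph on \<open>X\<close> is given by its set \<open>E\<close> of edges, which are two-element subsets of \<open>X\<close>.\<close>

definition graph_on :: "'x set \<Rightarrow> 'x set set \<Rightarrow> bool" where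
  "graph_on X E \<longleftrightarrow> finite X \<and> (\<forall>e \<in> E. e \<subseteq> X \<and> card e = 2)"

text \<open>The list \<open>\<pi>\<close> is the path \<open>\<pi> ! 0, \<dots>, \<pi> ! r\<close> with \<open>r = length \<pi> - 1\<close>; vertices may repeat.\<close>

definition is_path :: "'x set \<Rightarrow> 'x set set \<Rightarrow> 'x list \<Rightarrow> bool" where
  "is_path X E \<pi> \<longleftrightarrow> \<pi> \<noteq> [] \<and> set \<pi> \<subseteq> X \<and> successively (\<lambda>u v. {u, v} \<in> E) \<pi>"

text \<open>
  In the last clause the sequence \<open>ys\<close> enumerates a proper subset of the interior vertices
  without repetition, in any order.
\<close>

definition admissible ::
    "'x::linorder set \<Rightarrow> 'x set set \<Rightarrow> 'x \<Rightarrow> 'x \<Rightarrow> 'x list \<Rightarrow> bool" where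
  "admissible X E x y \<pi> \<longleftrightarrow>
     is_path X E \<pi> \<and> hd \<pi> = x \<and> last \<pi> = y \<and>
     distinct \<pi> \<and> x < y \<and>
     (\<forall>k \<in> {1..<length \<pi> - 1}. \<pi> ! k < x \<or> \<pi> ! k > y) \<and>
     (\<forall>ys. distinct ys \<and> set ys \<subset> (\<lambda>k. \<pi> ! k) ` {1..<length \<pi> - 1} \<longrightarrow>
        \<not> is_path X E (x # ys @ [y]))"

definition antitone_along :: "'x::linorder list \<Rightarrow> (nat \<Rightarrow> nat) \<Rightarrow> bool" where
  "antitone_along \<pi> \<kappa> \<longleftrightarrow>
     (\<forall>s < length \<pi>. \<forall>t < length \<pi>. \<pi> ! s < \<pi> ! t \<longrightarrow> \<kappa> s \<ge> \<kappa> t)"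

definition strictly_antitone_along :: "'x::linorder list \<Rightarrow> (nat \<Rightarrow> nat) \<Rightarrow> bool" where
  "strictly_antitone_along \<pi> \<kappa> \<longleftrightarrow> antitone_along \<pi> \<kappa> \<and> \<kappa> 0 > \<kappa> (length \<pi> - 1)"


section \<open>Binomial edge ideals\<close>

text \<open>The unknown $p_{ix}$ is indexed by the pair \<open>(i, x)\<close>.\<close>

definition unknowns :: "nat \<Rightarrow> 'x set \<Rightarrow> (nat \<times> 'x) set" where
  "unknowns d X = {1..d} \<times> X"

definition unknown_less :: "nat \<times> 'x::linorder \<Rightarrow> nat \<times> 'x \<Rightarrow> bool" where
  "unknown_less v w \<longleftrightarrow> fst v < fst w \<or> (fst v = fst w \<and> snd v < snd w)"

definition edge_binomial ::
    "nat \<Rightarrow> nat \<Rightarrow> 'x \<Rightarrow> 'x \<Rightarrow> (nat \<times> 'x, 'k::field) mpoly" where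
  "edge_binomial i j x y = var (i, x) * var (j, y) - var (i, y) * var (j, x)"

definition binomial_edge_ideal ::
    "nat \<Rightarrow> 'x set \<Rightarrow> 'x set set \<Rightarrow> (nat \<times> 'x, 'k::field) mpoly set" where
  "binomial_edge_ideal d X E =
     Idl\<^bsub>poly_ring (unknowns d X)\<^esub>
       {edge_binomial i j x y | i j x y. i \<in> {1..d} \<and> j \<in> {1..d} \<and> {x, y} \<in> E}"

definition path_monomial ::
    "'x list \<Rightarrow> (nat \<Rightarrow> nat) \<Rightarrow> (nat \<times> 'x, 'k::field) mpoly" where
  "path_monomial \<pi> \<kappa> = (\<Prod>k \<in> {1..<length \<pi> - 1}. var (\<kappa> k, \<pi> ! k))"

definition path_binomials ::
    "nat \<Rightarrow> 'x::linorder set \<Rightarrow> 'x set set \<Rightarrow> (nat \<times> 'x, 'k::field) mpoly set" where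
  "path_binomials d X E =
     {path_monomial \<pi> \<kappa> * edge_binomial (\<kappa> (length \<pi> - 1)) (\<kappa> 0) x y | \<pi> \<kappa> x y.
        x \<in> X \<and> y \<in> X \<and> x < y \<and> admissible X E x y \<pi> \<and>
        \<kappa> \<in> {0..length \<pi> - 1} \<rightarrow> {1..d} \<and> strictly_antitone_along \<pi> \<kappa>}"


section \<open>Sanity checks\<close>

lemma cring_poly_ring: "cring (poly_ring V :: ('v, 'k::field) mpoly ring)"
proof (rule cringI)
  show "abelian_group (poly_ring V :: ('v, 'k) mpoly ring)"
  proof (rule abelian_groupI)
    fix f :: "('v, 'k) mpoly" assume "f \<in> carrier (poly_ring V)"
    then show "\<exists>g \<in> carrier (poly_ring V). g \<oplus>\<^bsub>poly_ring V\<^esub> f = \<zero>\<^bsub>poly_ring V\<^esub>"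
      by (intro bexI[of _ "- f"]) (auto simp: poly_ring_def)
  next
    fix f g :: "('v, 'k) mpoly"
    assume "f \<in> carrier (poly_ring V)" "g \<in> carrier (poly_ring V)"
    then show "f \<oplus>\<^bsub>poly_ring V\<^esub> g \<in> carrier (poly_ring V)"
      using Poly_Mapping.keys_add[of f g] by (auto simp: poly_ring_def)
  qed (auto simp: poly_ring_def algebra_simps)
next
  show "Group.comm_monoid (poly_ring V :: ('v, 'k) mpoly ring)"
  proof (rule comm_monoidI)
    fix f g :: "('v, 'k) mpoly"
    assume fg: "f \<in> carrier (poly_ring V)" "g \<in> carrier (poly_ring V)"
    have "Poly_Mapping.keys m \<subseteq> V" if m: "m \<in> Poly_Mapping.keys (f * g)" for m
    proof -
      obtain a b where "m = a + b" "a \<in> Poly_Mapping.keys f" "b \<in> Poly_Mapping.keys g"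
        using Poly_Mapping.keys_mult[of f g] m by auto
      then show ?thesis
        using fg Poly_Mapping.keys_add[of a b] unfolding poly_ring_def by fastforce
    qed
    then show "f \<otimes>\<^bsub>poly_ring V\<^esub> g \<in> carrier (poly_ring V)"
      by (simp add: poly_ring_def)
  qed (auto simp: poly_ring_def algebra_simps)
qed (auto simp: poly_ring_def algebra_simps)

lemma lex_less_irrefl: "\<not> lex_less vless m m"
  by (simp add: lex_less_def)

lemma lex_less_trans:
  fixes l m n :: "(nat \<times> 'x::linorder) monomial"
  assumes "lex_less unknown_less l m" "lex_less unknown_less m n"
  shows "lex_less unknown_less l n"
proof -
  obtain v where v: "Poly_Mapping.lookup l v < Poly_Mapping.lookup m v"
      "\<And>w. unknown_less v w \<Longrightarrow> Poly_Mapping.lookup l w = Poly_Mapping.lookup m w"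
    using assms(1) by (auto simp: lex_less_def)
  obtain u where u: "Poly_Mapping.lookup m u < Poly_Mapping.lookup n u"
      "\<And>w. unknown_less u w \<Longrightarrow> Poly_Mapping.lookup m w = Poly_Mapping.lookup n w"
    using assms(2) by (auto simp: lex_less_def)
  have tr: "unknown_less a c" if "unknown_less a b" "unknown_less b c"
    for a b c :: "nat \<times> 'x"
    using that by (auto simp: unknown_less_def)
  consider "u = v" | "unknown_less u v" | "unknown_less v u"
    unfolding unknown_less_def prod_eq_iff by (meson linorder_neqE)
  then show ?thesis
  proof cases
    case 1
    then show ?thesis unfolding lex_less_def using u v by (intro exI[of _ v]) auto
  next
    case 2
    then show ?thesis unfolding lex_less_def using u v tr[OF 2]
      by (intro exI[of _ v]) auto
  next
    case 3
    then show ?thesis unfolding lex_less_def using u v tr[OF 3]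
      by (intro exI[of _ u]) auto
  qed
qed

lemma lex_less_total:
  fixes m n :: "(nat \<times> 'x::linorder) monomial"
  assumes "m \<noteq> n"
  shows "lex_less unknown_less m n \<or> lex_less unknown_less n m"
proof -
  define D where "D = {v. Poly_Mapping.lookup m v \<noteq> Poly_Mapping.lookup n v}"
  have "D \<subseteq> Poly_Mapping.keys m \<union> Poly_Mapping.keys n" by (auto simp: D_def in_keys_iff)
  then have fin: "finite D" by (rule finite_subset) simp
  have "D \<noteq> {}" using assms by (auto simp: D_def intro: poly_mapping_eqI)
  define i where "i = Max (fst ` D)"
  have i: "i \<in> fst ` D" "\<And>w. w \<in> D \<Longrightarrow> fst w \<le> i"
    unfolding i_def using fin \<open>D \<noteq> {}\<close> by (auto intro!: Max_in[of "fst ` D"])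
  define Y where "Y = snd ` {w \<in> D. fst w = i}"
  define x where "x = Max Y"
  have "finite Y" "Y \<noteq> {}" using fin i(1) by (auto simp: Y_def)
  then have x: "x \<in> Y" "\<And>z. z \<in> Y \<Longrightarrow> z \<le> x" by (auto simp: x_def)
  have mem: "(i, x) \<in> D" using x(1) by (auto simp: Y_def)
  have max: "w \<notin> D" if "unknown_less (i, x) w" for w
  proof
    assume "w \<in> D"
    then have "fst w \<le> i" "fst w = i \<Longrightarrow> snd w \<le> x" using i(2) x(2) by (auto simp: Y_def)
    then show False using that by (auto simp: unknown_less_def)
  qed
  show ?thesis
  proof (cases "Poly_Mapping.lookup m (i, x) < Poly_Mapping.lookup n (i, x)")
    case True
    then show ?thesis using max unfolding lex_less_def D_def by blast
  next
    case False
    with mem have "Poly_Mapping.lookup n (i, x) < Poly_Mapping.lookup m (i, x)"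
      by (simp add: D_def)
    then show ?thesis using max unfolding lex_less_def D_def
      by (metis (mono_tags, lifting) mem_Collect_eq)
  qed
qed

end

theory Submission
  imports Defs
begin

text \<open>
  Read an exponent of the unknown \<open>(i, x)\<close> as the number of pebbles of colour \<open>i\<close> lying on the vertex
  \<open>x\<close>. The two terms of a multiple of an edge generator then differ by exchanging the colours of two
  pebbles on adjacent vertices. Hence the binomial edge ideal is spanned by differences of pebble
  configurations that such swaps turn into each other, and every element of the ideal has coefficient
  sum zero over each set of monomials closed under swaps (\<open>binomial_edge_ideal_class_sum\<close>). This
  linear criterion replaces Buchberger's: no S-polynomial is ever reduced.

  Swaps do not change how many pebbles lie on a vertex, nor how often a colour occurs on a connected
  component of the graph induced on the occupied vertices. Let \<open>m\<close> be the leading monomial of a nonzero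
  element of the ideal. Since its coefficient has to cancel, a smaller monomial \<open>n\<close> with the same
  invariants exists. The lexicographic order prefers large colours on small vertices, so \<open>m\<close> cannot be
  sorted that way: it contains an inversion, that is, vertices \<open>x < y\<close> of one component and colours
  \<open>i < j\<close> on them, \<open>i\<close> on \<open>x\<close> and \<open>j\<close> on \<open>y\<close> (\<open>exists_inversion\<close>). A shortest path that joins an
  inverted pair through occupied vertices is admissible, and colours present on it form a strictly
  antitone colouring once the two end colours are exchanged, because any other inversion would be
  joined by a shorter path. So \<open>m\<close> is divisible by the leading monomial of a path binomial
  (\<open>exists_leading_unknowns_subset\<close>), which is the Groebner property.

  Path binomials belong to the ideal because exchanging the two end colours of a path is a
  composition of swaps along edges (\<open>path_swap_in_ideal\<close>). The basis is reduced because the leading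
  monomial of a path binomial has exactly one inversion, the pair of end points, and the trailing
  monomial has none: divisibility forces equal end points, and then minimality of admissible paths
  forces equal interiors (\<open>leading_unknowns_subset_imp_eq\<close>).
\<close>

section \<open>Monomials and leading terms\<close>

abbreviation lex_order :: "(nat \<times> 'x::linorder) monomial \<Rightarrow> (nat \<times> 'x) monomial \<Rightarrow> bool" where
  "lex_order \<equiv> lex_less unknown_less"

lemma keys_add_monomial:
  fixes a b :: "'v monomial"
  shows "Poly_Mapping.keys (a + b) = Poly_Mapping.keys a \<union> Poly_Mapping.keys b"
  by (auto simp: in_keys_iff lookup_add)

definition squarefree_monomial :: "'v set \<Rightarrow> 'v monomial" where
  "squarefree_monomial V = (\<Sum>v\<in>V. Poly_Mapping.single v 1)"

lemma lookup_squarefree_monomial: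
  "finite V \<Longrightarrow> Poly_Mapping.lookup (squarefree_monomial V) v = (if v \<in> V then 1 else 0)"
  by (simp add: squarefree_monomial_def lookup_sum lookup_single when_def)

lemma keys_squarefree_monomial:
  "finite V \<Longrightarrow> Poly_Mapping.keys (squarefree_monomial V) = V"
  by (auto simp: in_keys_iff lookup_squarefree_monomial split: if_splits)

lemma squarefree_monomial_dvd_iff:
  assumes "finite V"
  shows "monomial_dvd (squarefree_monomial V) m \<longleftrightarrow> V \<subseteq> Poly_Mapping.keys m"
proof
  assume "monomial_dvd (squarefree_monomial V) m"
  then show "V \<subseteq> Poly_Mapping.keys m"
    using assms by (auto simp: monomial_dvd_def keys_add_monomial keys_squarefree_monomial)
next
  assume V: "V \<subseteq> Poly_Mapping.keys m"
  have "m = squarefree_monomial V + (m - squarefree_monomial V)"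
  proof (rule poly_mapping_eqI)
    fix v
    have "v \<in> V \<Longrightarrow> Poly_Mapping.lookup m v \<ge> 1"
      using V by (auto simp: in_keys_iff Suc_le_eq)
    then show "Poly_Mapping.lookup m v =
        Poly_Mapping.lookup (squarefree_monomial V + (m - squarefree_monomial V)) v"
      using assms by (simp add: lookup_add lookup_minus lookup_squarefree_monomial)
  qed
  then show "monomial_dvd (squarefree_monomial V) m"
    by (auto simp: monomial_dvd_def)
qed

lemma prod_var:
  assumes "finite V"
  shows "(\<Prod>v\<in>V. var v) = (Poly_Mapping.single (squarefree_monomial V) 1 :: ('v, 'k::field) mpoly)"
  using assms
proof (induction V rule: finite_induct)
  case empty
  then show ?case by (simp add: squarefree_monomial_def flip: single_one)
next
  case (insert v V)
  then show ?case by (simp add: var_def mult_single squarefree_monomial_def)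
qed

lemma leading_monomialI:
  assumes "m \<in> Poly_Mapping.keys f"
    and "\<And>n. n \<in> Poly_Mapping.keys f \<Longrightarrow> n \<noteq> m \<Longrightarrow> lex_order n m"
  shows "leading_monomial lex_order f = m"
  unfolding leading_monomial_def
proof (rule the_equality)
  fix n assume n: "n \<in> Poly_Mapping.keys f \<and> (\<forall>k\<in>Poly_Mapping.keys f. k \<noteq> n \<longrightarrow> lex_order k n)"
  show "n = m"
  proof (rule ccontr)
    assume "n \<noteq> m"
    then have "lex_order n m" "lex_order m n" using assms n by auto
    then show False using lex_less_trans lex_less_irrefl by blast
  qed
qed (use assms in auto)

lemma leading_monomial_greatest:
  fixes f :: "(nat \<times> 'x::linorder, 'k::field) mpoly"
  assumes "f \<noteq> 0"
  shows "leading_monomial lex_order f \<in> Poly_Mapping.keys f"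
    and "\<And>n. n \<in> Poly_Mapping.keys f \<Longrightarrow> n \<noteq> leading_monomial lex_order f \<Longrightarrow>
              lex_order n (leading_monomial lex_order f)"
proof -
  have "\<exists>m\<in>A. \<forall>n\<in>A. n \<noteq> m \<longrightarrow> lex_order n m" if "finite A" "A \<noteq> {}"
    for A :: "(nat \<times> 'x) monomial set"
    using that
  proof (induction A rule: finite_ne_induct)
    case (insert a A)
    then obtain m where m: "m \<in> A" "\<forall>n\<in>A. n \<noteq> m \<longrightarrow> lex_order n m" by blast
    with insert have "a \<noteq> m" by auto
    then consider "lex_order a m" | "lex_order m a" using lex_less_total by blast
    then show ?case
    proof cases
      case 1
      then show ?thesis using m by auto
    next
      case 2
      then have "lex_order n a" if "n \<in> A" for n
        using m that lex_less_trans[of n m a] by (cases "n = m") auto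
      then show ?thesis by auto
    qed
  qed auto
  moreover have "Poly_Mapping.keys f \<noteq> {}"
    using assms by (metis poly_mapping_eqI lookup_zero in_keys_iff empty_iff)
  ultimately obtain m where m: "m \<in> Poly_Mapping.keys f"
      "\<forall>n\<in>Poly_Mapping.keys f. n \<noteq> m \<longrightarrow> lex_order n m"
    by (metis finite_keys)
  then have "leading_monomial lex_order f = m" by (intro leading_monomialI) auto
  with m show "leading_monomial lex_order f \<in> Poly_Mapping.keys f"
    and "\<And>n. n \<in> Poly_Mapping.keys f \<Longrightarrow> n \<noteq> leading_monomial lex_order f \<Longrightarrow>
              lex_order n (leading_monomial lex_order f)"
    by auto
qed

lemma binomial_leading_data:
  assumes "lex_order n m"
  defines "f \<equiv> Poly_Mapping.single m 1 - Poly_Mapping.single n 1 :: (nat \<times> 'x::linorder, 'k::field) mpoly"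
  shows "Poly_Mapping.keys f = {m, n}" "leading_monomial lex_order f = m" "leading_coeff lex_order f = 1"
proof -
  have ne: "m \<noteq> n" using assms lex_less_irrefl by blast
  then show k: "Poly_Mapping.keys f = {m, n}"
    by (auto simp: f_def in_keys_iff lookup_minus lookup_single when_def split: if_splits)
  show "leading_monomial lex_order f = m"
    by (rule leading_monomialI) (use k assms in auto)
  then show "leading_coeff lex_order f = 1"
    using ne by (simp add: leading_coeff_def f_def lookup_minus lookup_single)
qed

lemma poly_ring_simps [simp]:
  "f \<in> carrier (poly_ring V) \<longleftrightarrow> (\<forall>m\<in>Poly_Mapping.keys f. Poly_Mapping.keys m \<subseteq> V)"
  "f \<otimes>\<^bsub>poly_ring V\<^esub> g = f * g" "f \<oplus>\<^bsub>poly_ring V\<^esub> g = f + g"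
  "\<zero>\<^bsub>poly_ring V\<^esub> = 0" "\<one>\<^bsub>poly_ring V\<^esub> = 1"
  by (simp_all add: poly_ring_def)

lemma ring_poly_ring: "ring (poly_ring V :: ('v, 'k::field) mpoly ring)"
  using cring_poly_ring cring.axioms(1) by blast

lemma var_in_carrier: "v \<in> V \<Longrightarrow> var v \<in> carrier (poly_ring V)"
  by (simp add: var_def)

lemma edge_binomial_in_carrier:
  assumes "i \<in> {1..d}" "j \<in> {1..d}" "x \<in> X" "y \<in> X"
  shows "edge_binomial i j x y \<in> carrier (poly_ring (unknowns d X))"
proof -
  have "Poly_Mapping.keys (edge_binomial i j x y :: (nat \<times> 'a, 'b) mpoly) \<subseteq>
      {Poly_Mapping.single (i, x) 1 + Poly_Mapping.single (j, y) 1,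
       Poly_Mapping.single (i, y) 1 + Poly_Mapping.single (j, x) 1}"
    by (auto simp: edge_binomial_def var_def mult_single in_keys_iff lookup_minus lookup_single
        when_def split: if_splits)
  then show ?thesis
    using assms by (auto simp: unknowns_def keys_add_monomial dest!: subsetD)
qed

section \<open>Coefficient sums over swap classes\<close>

definition class_sum :: "'v monomial set \<Rightarrow> ('v, 'k::field) mpoly \<Rightarrow> 'k" where
  "class_sum K f = (\<Sum>m\<in>Poly_Mapping.keys f. if m \<in> K then Poly_Mapping.lookup f m else 0)"

lemma class_sum_superset:
  assumes "finite A" "Poly_Mapping.keys f \<subseteq> A"
  shows "class_sum K f = (\<Sum>m\<in>A. if m \<in> K then Poly_Mapping.lookup f m else 0)"
  unfolding class_sum_def
  by (rule sum.mono_neutral_left) (use assms in \<open>auto simp: in_keys_iff\<close>)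

lemma class_sum_add: "class_sum K (f + g) = class_sum K f + class_sum K g"
proof -
  let ?A = "Poly_Mapping.keys f \<union> Poly_Mapping.keys g"
  have "Poly_Mapping.keys (f + g) \<subseteq> ?A" by (rule keys_add)
  then show ?thesis
    using class_sum_superset[of ?A f K] class_sum_superset[of ?A g K]
      class_sum_superset[of ?A "f + g" K]
    by (simp flip: sum.distrib) (rule sum.cong, auto simp: lookup_add)
qed

lemma class_sum_zero [simp]: "class_sum K 0 = 0"
  by (simp add: class_sum_def)

lemma class_sum_minus: "class_sum K (f - g) = class_sum K f - class_sum K g"
  using class_sum_add[of K "f - g" g] by simp

lemma class_sum_sum:
  "finite A \<Longrightarrow> class_sum K (\<Sum>a\<in>A. f a) = (\<Sum>a\<in>A. class_sum K (f a))"
  by (induction A rule: finite_induct) (simp_all add: class_sum_add)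

lemma class_sum_single: "class_sum K (Poly_Mapping.single m c) = (if m \<in> K then c else 0)"
  using class_sum_superset[of "{m}" "Poly_Mapping.single m c" K] by simp

lemma poly_eq_sum_single:
  "f = (\<Sum>m\<in>Poly_Mapping.keys f. Poly_Mapping.single m (Poly_Mapping.lookup f m))"
  by (rule poly_mapping_eqI) (simp add: lookup_sum lookup_single when_def in_keys_iff)

text \<open>
  Multiplication by a monomial \<open>t\<close> translates exponents, so summing over \<open>K\<close> after multiplying is
  summing over the preimage of \<open>K\<close> under that translation before.
\<close>

lemma class_sum_mult:
  "class_sum K (h * f) =
     (\<Sum>t\<in>Poly_Mapping.keys h. Poly_Mapping.lookup h t * class_sum {m. t + m \<in> K} f)"
proof -
  have "h * f = (\<Sum>t\<in>Poly_Mapping.keys h. \<Sum>m\<in>Poly_Mapping.keys f.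
      Poly_Mapping.single (t + m) (Poly_Mapping.lookup h t * Poly_Mapping.lookup f m))"
    by (subst poly_eq_sum_single[of h], subst poly_eq_sum_single[of f])
      (simp add: sum_product mult_single)
  then show ?thesis
    by (simp add: class_sum_sum class_sum_single)
      (auto simp: class_sum_def sum_distrib_left intro!: sum.cong)
qed

text \<open>
  The two monomials of \<open>t\<close> times an edge generator.
\<close>

definition edge_swap ::
    "nat \<Rightarrow> 'x set set \<Rightarrow> (nat \<times> 'x) monomial \<Rightarrow> (nat \<times> 'x) monomial \<Rightarrow> bool" where
  "edge_swap d E m n \<longleftrightarrow> (\<exists>t i j x y. {x, y} \<in> E \<and> i \<in> {1..d} \<and> j \<in> {1..d} \<and>
     m = t + (Poly_Mapping.single (i, x) 1 + Poly_Mapping.single (j, y) 1) \<and>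
     n = t + (Poly_Mapping.single (i, y) 1 + Poly_Mapping.single (j, x) 1))"

text \<open>
  One implication is enough for unions of swap classes, since swaps are reversible.
\<close>

definition swap_closed :: "nat \<Rightarrow> 'x set set \<Rightarrow> (nat \<times> 'x) monomial set \<Rightarrow> bool" where
  "swap_closed d E K \<longleftrightarrow> (\<forall>m n. edge_swap d E m n \<longrightarrow> m \<in> K \<longrightarrow> n \<in> K)"

lemma edge_swap_sym:
  assumes "edge_swap d E m n"
  shows "edge_swap d E n m"
proof -
  obtain t i j x y where "{x, y} \<in> E \<and> i \<in> {1..d} \<and> j \<in> {1..d} \<and>
      m = t + (Poly_Mapping.single (i, x) 1 + Poly_Mapping.single (j, y) 1) \<and>
      n = t + (Poly_Mapping.single (i, y) 1 + Poly_Mapping.single (j, x) 1)"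
    using assms unfolding edge_swap_def by blast
  then show ?thesis
    unfolding edge_swap_def by (intro exI[of _ t] exI[of _ i] exI[of _ j] exI[of _ y] exI[of _ x])
      (auto simp: insert_commute)
qed

lemma edge_swap_translate:
  assumes "edge_swap d E m n"
  shows "edge_swap d E (t + m) (t + n)"
proof -
  obtain s i j x y where "{x, y} \<in> E \<and> i \<in> {1..d} \<and> j \<in> {1..d} \<and>
      m = s + (Poly_Mapping.single (i, x) 1 + Poly_Mapping.single (j, y) 1) \<and>
      n = s + (Poly_Mapping.single (i, y) 1 + Poly_Mapping.single (j, x) 1)"
    using assms unfolding edge_swap_def by blast
  then show ?thesis
    unfolding edge_swap_def by (intro exI[of _ "t + s"] exI[of _ i] exI[of _ j] exI[of _ x] exI[of _ y])
      (auto simp: add.assoc)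
qed

lemma swap_closed_translate: "swap_closed d E K \<Longrightarrow> swap_closed d E {m. t + m \<in> K}"
  using edge_swap_translate unfolding swap_closed_def by blast

lemma edge_binomial_class_sum:
  assumes "swap_closed d E K" "{x, y} \<in> E" "i \<in> {1..d}" "j \<in> {1..d}"
  shows "class_sum K (edge_binomial i j x y :: (nat \<times> 'x, 'k::field) mpoly) = 0"
proof -
  let ?m = "Poly_Mapping.single (i, x) 1 + Poly_Mapping.single (j, y) 1 :: (nat \<times> 'x) monomial"
  let ?n = "Poly_Mapping.single (i, y) 1 + Poly_Mapping.single (j, x) 1 :: (nat \<times> 'x) monomial"
  have "edge_swap d E ?m ?n"
    unfolding edge_swap_def using assms(2-) by (metis add_0)
  then have "?m \<in> K \<longleftrightarrow> ?n \<in> K"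
    using assms(1) edge_swap_sym unfolding swap_closed_def by blast
  then show ?thesis
    by (simp add: edge_binomial_def var_def mult_single class_sum_minus class_sum_single)
qed

text \<open>
  The conditions for all swap-closed sets together define an ideal, although a single one does not:
  multiplication by a monomial moves the condition for \<open>K\<close> to a translate of \<open>K\<close>, which is again
  swap-closed.
\<close>

lemma class_sum_ideal:
  "ideal {f \<in> carrier (poly_ring (unknowns d X)). \<forall>K. swap_closed d E K \<longrightarrow> class_sum K f = 0}
     (poly_ring (unknowns d X) :: (nat \<times> 'x, 'k::field) mpoly ring)"
    (is "ideal ?J ?R")
proof -
  interpret cring ?R by (rule cring_poly_ring)
  have mult: "h * f \<in> ?J" if "f \<in> ?J" "h \<in> carrier ?R" for f h
  proof -
    have "h \<otimes>\<^bsub>?R\<^esub> f \<in> carrier ?R" using that by (intro m_closed) blast+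
    moreover have "class_sum K (h * f) = 0" if "swap_closed d E K" for K
      using \<open>f \<in> ?J\<close> swap_closed_translate[OF that] by (simp add: class_sum_mult)
    ultimately show ?thesis by (simp del: poly_ring_simps(1))
  qed
  show ?thesis
  proof (rule idealI[OF ring_axioms])
    show "subgroup ?J (add_monoid ?R)"
    proof
      fix f g assume fg: "f \<in> ?J" "g \<in> ?J"
      then have "f \<oplus>\<^bsub>?R\<^esub> g \<in> carrier ?R" by (intro a_closed) blast+
      with fg show "f \<otimes>\<^bsub>add_monoid ?R\<^esub> g \<in> ?J"
        by (auto simp: class_sum_add simp del: poly_ring_simps(1))
    next
      fix f assume f: "f \<in> ?J"
      then have c: "\<ominus>\<^bsub>?R\<^esub> f \<in> carrier ?R" by (intro a_inv_closed) blast
      have "f \<oplus>\<^bsub>?R\<^esub> \<ominus>\<^bsub>?R\<^esub> f = 0" using f by (subst r_neg) auto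
      then have "class_sum K f + class_sum K (\<ominus>\<^bsub>?R\<^esub> f) = 0" for K
        by (metis class_sum_add class_sum_zero poly_ring_simps(3))
      then show "inv\<^bsub>add_monoid ?R\<^esub> f \<in> ?J"
        using f c unfolding a_inv_def[symmetric] by (simp del: poly_ring_simps(1))
          (metis add_0)
    qed auto
  next
    fix f h assume fh: "f \<in> ?J" "h \<in> carrier ?R"
    show "h \<otimes>\<^bsub>?R\<^esub> f \<in> ?J" "f \<otimes>\<^bsub>?R\<^esub> h \<in> ?J"
      using mult[OF fh] by (simp_all add: mult.commute del: poly_ring_simps(1))
  qed
qed

lemma edge_generators_in_carrier:
  assumes "graph_on X E"
  shows "{edge_binomial i j x y | i j x y. i \<in> {1..d} \<and> j \<in> {1..d} \<and> {x, y} \<in> E} \<subseteq>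
      carrier (poly_ring (unknowns d X) :: (nat \<times> 'x, 'k::field) mpoly ring)"
proof -
  have "x \<in> X" "y \<in> X" if "{x, y} \<in> E" for x y
    using assms that by (auto simp: graph_on_def)
  then show ?thesis
    by (auto simp del: poly_ring_simps(1) atLeastAtMost_iff intro!: edge_binomial_in_carrier)
qed

lemma ideal_binomial_edge_ideal:
  assumes "graph_on X E"
  shows "ideal (binomial_edge_ideal d X E) (poly_ring (unknowns d X) :: (nat \<times> 'x, 'k::field) mpoly ring)"
  unfolding binomial_edge_ideal_def
  by (rule ring.genideal_ideal[OF ring_poly_ring edge_generators_in_carrier[OF assms]])

lemma edge_binomial_in_ideal:
  assumes "graph_on X E" "{x, y} \<in> E" "i \<in> {1..d}" "j \<in> {1..d}"
  shows "(edge_binomial i j x y :: (nat \<times> 'x, 'k::field) mpoly) \<in> binomial_edge_ideal d X E"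
  unfolding binomial_edge_ideal_def
  by (rule subsetD[OF ring.genideal_self[OF ring_poly_ring edge_generators_in_carrier[OF assms(1)]]])
    (use assms(2-) in blast)

text \<open>
  Both monomials of a generator lie in \<open>K\<close> or neither does, and their coefficients cancel; the ideal
  above therefore contains all generators.
\<close>

lemma binomial_edge_ideal_class_sum:
  fixes f :: "(nat \<times> 'x, 'k::field) mpoly"
  assumes "graph_on X E" "f \<in> binomial_edge_ideal d X E" "swap_closed d E K"
  shows "class_sum K f = 0"
proof -
  let ?J = "{f \<in> carrier (poly_ring (unknowns d X)).
      \<forall>K. swap_closed d E K \<longrightarrow> class_sum K (f :: (nat \<times> 'x, 'k) mpoly) = 0}"
  have "{edge_binomial i j x y | i j x y. i \<in> {1..d} \<and> j \<in> {1..d} \<and> {x, y} \<in> E} \<subseteq> ?J"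
  proof
    fix g :: "(nat \<times> 'x, 'k) mpoly"
    assume g: "g \<in> {edge_binomial i j x y | i j x y. i \<in> {1..d} \<and> j \<in> {1..d} \<and> {x, y} \<in> E}"
    then have "g \<in> carrier (poly_ring (unknowns d X))"
      by (rule subsetD[OF edge_generators_in_carrier[OF assms(1)]])
    moreover obtain i j x y where "{x, y} \<in> E" "i \<in> {1..d}" "j \<in> {1..d}" "g = edge_binomial i j x y"
      using g by blast
    then have "\<forall>K. swap_closed d E K \<longrightarrow> class_sum K g = 0"
      using edge_binomial_class_sum by metis
    ultimately show "g \<in> ?J" by (simp del: poly_ring_simps(1))
  qed
  then have "binomial_edge_ideal d X E \<subseteq> ?J"
    unfolding binomial_edge_ideal_def by (intro ring.genideal_minimal ring_poly_ring class_sum_ideal)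
  then show ?thesis using assms by blast
qed

section \<open>Sorted monomials are least in their class\<close>

definition count :: "'v set \<Rightarrow> 'v monomial \<Rightarrow> nat" where
  "count S m = (\<Sum>v\<in>S. Poly_Mapping.lookup m v)"

lemma count_add: "count S (m + n) = count S m + count S n"
  by (simp add: count_def lookup_add sum.distrib)

lemma count_single: "finite S \<Longrightarrow> count S (Poly_Mapping.single v c) = (if v \<in> S then c else 0)"
  by (simp add: count_def lookup_single when_def)

text \<open>
  The graph induced on the occupied vertices, as a symmetric relation.
\<close>

definition support_edges :: "'x set set \<Rightarrow> (nat \<times> 'x) monomial \<Rightarrow> ('x \<times> 'x) set" where
  "support_edges E m =
     {(u, v). {u, v} \<in> E \<and> u \<in> snd ` Poly_Mapping.keys m \<and> v \<in> snd ` Poly_Mapping.keys m}"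

definition component :: "'x set set \<Rightarrow> (nat \<times> 'x) monomial \<Rightarrow> 'x \<Rightarrow> 'x set" where
  "component E m x = (support_edges E m)\<^sup>* `` {x}"

lemma finite_component: "finite (component E m x)"
proof -
  have "component E m x \<subseteq> insert x (snd ` Poly_Mapping.keys m)"
    unfolding component_def by (auto elim: rtranclE simp: support_edges_def)
  then show ?thesis by (rule finite_subset) auto
qed

text \<open>
  The monomials that agree with \<open>m\<close> in all invariants of swapping. The components are those of \<open>m\<close>,
  a fixed monomial, so that each condition is linear in the exponents. This loses nothing for
  monomials in the colours \<open>1, \<dots>, d\<close>: equal vertex degrees mean the same occupied vertices.
\<close>

definition rearrangements ::
    "nat \<Rightarrow> 'x set set \<Rightarrow> (nat \<times> 'x) monomial \<Rightarrow> (nat \<times> 'x) monomial set" where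
  "rearrangements d E m = {n.
     (\<forall>x. count ({1..d} \<times> {x}) n = count ({1..d} \<times> {x}) m) \<and>
     (\<forall>i x. count ({i} \<times> component E m x) n = count ({i} \<times> component E m x) m)}"

text \<open>
  A swap uses two occupied adjacent vertices, which lie in the same component.
\<close>

lemma swap_closed_rearrangements: "swap_closed d E (rearrangements d E m)"
  unfolding swap_closed_def
proof (intro allI impI)
  fix a b assume ab: "edge_swap d E a b" and a: "a \<in> rearrangements d E m"
  obtain t i j x y where e: "{x, y} \<in> E" and ij: "i \<in> {1..d}" "j \<in> {1..d}"
    and a_eq: "a = t + (Poly_Mapping.single (i, x) 1 + Poly_Mapping.single (j, y) 1)"
    and b_eq: "b = t + (Poly_Mapping.single (i, y) 1 + Poly_Mapping.single (j, x) 1)"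
    using ab unfolding edge_swap_def by blast
  have deg: "count ({1..d} \<times> {z}) b = count ({1..d} \<times> {z}) a" for z
    using ij by (simp add: a_eq b_eq count_add count_single)
  have supp: "z \<in> snd ` Poly_Mapping.keys m" if "z = x \<or> z = y" for z
  proof -
    have "count ({1..d} \<times> {z}) a > 0"
      using that ij by (auto simp: a_eq count_add count_single)
    then have "count ({1..d} \<times> {z}) m > 0" using a by (simp add: rearrangements_def)
    then obtain v where "v \<in> {1..d} \<times> {z}" "Poly_Mapping.lookup m v \<noteq> 0"
      unfolding count_def by (metis less_numeral_extra(3) sum.neutral)
    then show ?thesis by (force simp: in_keys_iff)
  qed
  then have "(x, y) \<in> support_edges E m" "(y, x) \<in> support_edges E m"
    using e by (auto simp: support_edges_def insert_commute)
  then have "x \<in> component E m z \<longleftrightarrow> y \<in> component E m z" for z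
    unfolding component_def by (auto intro: rtrancl_into_rtrancl)
  then have "count ({k} \<times> component E m z) b = count ({k} \<times> component E m z) a" for k z
    using finite_component[of E m z] by (simp add: a_eq b_eq count_add count_single)
  then show "b \<in> rearrangements d E m" using a deg by (simp add: rearrangements_def)
qed

text \<open>
  Let \<open>(j, y)\<close> be the largest unknown where \<open>n\<close> and \<open>m\<close> differ. The surplus of colour \<open>j\<close> that \<open>m\<close>
  has on \<open>y\<close> is balanced in the same component, necessarily on a smaller vertex \<open>x\<close>; the surplus of
  \<open>n\<close> at \<open>(j, x)\<close> is balanced by another colour on \<open>x\<close>, necessarily a smaller colour \<open>i\<close>.
\<close>

lemma exists_inversion:
  fixes m n :: "(nat \<times> 'x::linorder) monomial"
  assumes keys: "Poly_Mapping.keys m \<subseteq> unknowns d X"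
    and n: "n \<in> rearrangements d E m" and less: "lex_order n m"
  obtains i j x y where "x < y" "i < j" "(x, y) \<in> (support_edges E m)\<^sup>*"
    "(i, x) \<in> Poly_Mapping.keys m" "(j, y) \<in> Poly_Mapping.keys m"
proof -
  obtain j y where lt: "Poly_Mapping.lookup n (j, y) < Poly_Mapping.lookup m (j, y)"
    and above: "\<And>w. unknown_less (j, y) w \<Longrightarrow> Poly_Mapping.lookup n w = Poly_Mapping.lookup m w"
    using less unfolding lex_less_def by auto
  have jy: "(j, y) \<in> Poly_Mapping.keys m" using lt by (auto simp: in_keys_iff)
  let ?C = "component E m y"
  have "\<exists>w\<in>{j} \<times> ?C. Poly_Mapping.lookup m w < Poly_Mapping.lookup n w"
  proof (rule ccontr)
    assume "\<not> ?thesis"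
    then have "count ({j} \<times> ?C) n < count ({j} \<times> ?C) m"
      unfolding count_def using lt finite_component[of E m y]
      by (intro sum_strict_mono_ex1) (auto simp: not_less component_def)
    then show False using n by (simp add: rearrangements_def)
  qed
  then obtain x where x: "x \<in> ?C" "Poly_Mapping.lookup m (j, x) < Poly_Mapping.lookup n (j, x)"
    by auto
  have "x < y"
    using x(2) lt above[of "(j, x)"] by (cases x y rule: linorder_cases) (auto simp: unknown_less_def)
  have "\<exists>w\<in>{1..d} \<times> {x}. Poly_Mapping.lookup n w < Poly_Mapping.lookup m w"
  proof (rule ccontr)
    assume "\<not> ?thesis"
    moreover have "j \<in> {1..d}" using jy keys by (auto simp: unknowns_def)
    ultimately have "count ({1..d} \<times> {x}) m < count ({1..d} \<times> {x}) n"
      unfolding count_def using x(2) by (intro sum_strict_mono_ex1) (auto simp: not_less)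
    then show False using n by (simp add: rearrangements_def)
  qed
  then obtain i where i: "Poly_Mapping.lookup n (i, x) < Poly_Mapping.lookup m (i, x)" by auto
  then have "i < j"
    using x(2) above[of "(i, x)"] by (cases i j rule: linorder_cases) (auto simp: unknown_less_def)
  moreover have "(i, x) \<in> Poly_Mapping.keys m" using i by (auto simp: in_keys_iff)
  moreover have "sym (support_edges E m)"
    by (auto simp: sym_def support_edges_def insert_commute)
  then have "(x, y) \<in> (support_edges E m)\<^sup>*"
    using x(1) sym_rtrancl unfolding component_def sym_def by blast
  ultimately show ?thesis using that \<open>x < y\<close> jy by blast
qed

section \<open>Shortest paths between inverted vertices\<close>

lemma rtrancl_support_edges_path:
  assumes "(x, y) \<in> (support_edges E m)\<^sup>*" "x \<in> snd ` Poly_Mapping.keys m"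
  shows "\<exists>\<pi>. is_path (snd ` Poly_Mapping.keys m) E \<pi> \<and> hd \<pi> = x \<and> last \<pi> = y"
  using assms
proof (induction rule: rtrancl_induct)
  case base
  then show ?case by (intro exI[of _ "[x]"]) (auto simp: is_path_def)
next
  case (step y z)
  then obtain \<pi> where "is_path (snd ` Poly_Mapping.keys m) E \<pi>" "hd \<pi> = x" "last \<pi> = y" by blast
  with step.hyps show ?case
    by (intro exI[of _ "\<pi> @ [z]"]) (auto simp: is_path_def successively_append_iff support_edges_def)
qed

text \<open>
  Both directions of travel are needed: an inversion orders its vertices by size, not by their
  position on the path.
\<close>

lemma subpath:
  assumes "is_path S E \<pi>" "k < length \<pi>" "l < length \<pi>"
  obtains \<rho> where "is_path S E \<rho>" "hd \<rho> = \<pi> ! k" "last \<rho> = \<pi> ! l"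
    "length \<rho> = (if k \<le> l then l - k else k - l) + 1"
proof -
  have *: "\<exists>\<rho>. is_path S E \<rho> \<and> hd \<rho> = \<pi> ! k \<and> last \<rho> = \<pi> ! l \<and> length \<rho> = l - k + 1"
    if "k \<le> l" "l < length \<pi>" for k l
  proof -
    let ?\<rho> = "take (l - k + 1) (drop k \<pi>)"
    have "length ?\<rho> = l - k + 1" using that by simp
    moreover have "is_path S E ?\<rho>"
      using assms(1) that by (auto simp: is_path_def successively_conv_nth dest: in_set_takeD in_set_dropD)
    moreover have "hd ?\<rho> = \<pi> ! k" using that by (simp add: hd_drop_conv_nth)
    moreover have "last ?\<rho> = \<pi> ! l" using that by (subst last_conv_nth) auto
    ultimately show ?thesis by blast
  qed
  show ?thesis
  proof (cases "k \<le> l")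
    case True
    then show ?thesis using *[OF True assms(3)] that by auto
  next
    case False
    then obtain \<rho> where \<rho>: "is_path S E \<rho>" "hd \<rho> = \<pi> ! l" "last \<rho> = \<pi> ! k" "length \<rho> = k - l + 1"
      using *[of l k] assms(2) by auto
    then have "\<rho> \<noteq> []" by auto
    then show ?thesis
      using \<rho> False by (intro that[of "rev \<rho>"]) (auto simp: is_path_def hd_rev last_rev insert_commute)
  qed
qed

lemma shortcut_repetition:
  assumes "is_path S E \<pi>" "\<not> distinct \<pi>"
  obtains \<rho> where "is_path S E \<rho>" "hd \<rho> = hd \<pi>" "last \<rho> = last \<pi>" "length \<rho> < length \<pi>"
proof -
  obtain xs ys zs y where \<pi>: "\<pi> = xs @ [y] @ ys @ [y] @ zs"
    using not_distinct_decomp[OF assms(2)] by blast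
  show ?thesis
    by (rule that[of "xs @ [y] @ zs"])
      (use assms(1) \<pi> in \<open>auto simp: is_path_def successively_append_iff successively_Cons hd_append\<close>)
qed

lemma interior_image_eq:
  assumes "\<pi> \<noteq> []"
  shows "(\<lambda>k. \<pi> ! k) ` {1..<length \<pi> - 1} = set (butlast (tl \<pi>))"
proof -
  have "butlast (tl \<pi>) = map (\<lambda>k. \<pi> ! Suc k) [0..<length \<pi> - 2]"
    by (rule nth_equalityI) (auto simp: nth_butlast nth_tl)
  then have "set (butlast (tl \<pi>)) = (\<lambda>k. \<pi> ! Suc k) ` {0..<length \<pi> - 2}" by simp
  moreover have "{1..<length \<pi> - 1} = Suc ` {0..<length \<pi> - 2}"
    unfolding image_Suc_atLeastLessThan by auto
  ultimately show ?thesis by (simp only: image_image)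
qed

text \<open>
  The colouring \<open>\<kappa>\<close> with its two end colours exchanged: the first vertex carries the last colour and
  vice versa. Strictness of \<open>\<kappa>\<close> at the ends becomes an inversion.
\<close>

definition leading_unknowns :: "'x list \<Rightarrow> (nat \<Rightarrow> nat) \<Rightarrow> (nat \<times> 'x) set" where
  "leading_unknowns \<pi> \<kappa> = insert (\<kappa> (length \<pi> - 1), hd \<pi>) (insert (\<kappa> 0, last \<pi>)
     ((\<lambda>k. (\<kappa> k, \<pi> ! k)) ` {1..<length \<pi> - 1}))"

text \<open>
  Among all paths through vertices of \<open>A\<close> that join an inverted pair, a shortest one works. Every
  proper segment of it joins vertices without inversion. Comparing an interior vertex with the two
  ends puts it outside the interval between them, since any of its colours is either above the
  smaller or below the larger end colour. The same comparisons say that every choice of colours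
  for the interior is antitone.
\<close>

lemma exists_leading_unknowns_subset:
  fixes A :: "(nat \<times> 'x::linorder) set"
  assumes "is_path (snd ` A) E \<pi>\<^sub>0" "hd \<pi>\<^sub>0 < last \<pi>\<^sub>0" "i\<^sub>0 < j\<^sub>0"
    "(i\<^sub>0, hd \<pi>\<^sub>0) \<in> A" "(j\<^sub>0, last \<pi>\<^sub>0) \<in> A" "snd ` A \<subseteq> X"
  obtains \<pi> \<kappa> where "admissible X E (hd \<pi>) (last \<pi>) \<pi>" "strictly_antitone_along \<pi> \<kappa>"
    "leading_unknowns \<pi> \<kappa> \<subseteq> A"
proof -
  define inverted where "inverted \<pi> \<longleftrightarrow> is_path (snd ` A) E \<pi> \<and> hd \<pi> < last \<pi> \<and>
      (\<exists>i j. i < j \<and> (i, hd \<pi>) \<in> A \<and> (j, last \<pi>) \<in> A)" for \<pi>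
  have "inverted \<pi>\<^sub>0" using assms inverted_def by blast
  then obtain \<pi> where inv: "inverted \<pi>" and short: "\<And>\<rho>. inverted \<rho> \<Longrightarrow> length \<pi> \<le> length \<rho>"
    using ex_has_least_nat[of inverted \<pi>\<^sub>0 length] by blast
  define r where "r = length \<pi> - 1"
  obtain i j where path: "is_path (snd ` A) E \<pi>" and xy: "hd \<pi> < last \<pi>" and ij: "i < j"
    and iA: "(i, hd \<pi>) \<in> A" and jA: "(j, last \<pi>) \<in> A"
    using inv inverted_def by blast
  have ne: "\<pi> \<noteq> []" using path is_path_def by blast
  then have len: "length \<pi> = Suc r" by (cases \<pi>) (auto simp: r_def)
  have hd: "hd \<pi> = \<pi> ! 0" and last: "last \<pi> = \<pi> ! r"
    using ne by (simp_all add: hd_conv_nth last_conv_nth r_def)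
  with xy have r: "r > 0" by (cases r) auto
  have dist: "distinct \<pi>"
  proof (rule ccontr)
    assume "\<not> distinct \<pi>"
    then obtain \<rho> where "is_path (snd ` A) E \<rho>" "hd \<rho> = hd \<pi>" "last \<rho> = last \<pi>"
        "length \<rho> < length \<pi>"
      using shortcut_repetition[OF path] by metis
    then show False using short[of \<rho>] xy ij iA jA inverted_def by fastforce
  qed
  \<comment> \<open>any two vertices of the path other than the pair of ends are joined by a shorter path\<close>
  have sorted: "b \<le> a" if "k \<le> r" "l \<le> r" "{k, l} \<noteq> {0, r}" "\<pi> ! k < \<pi> ! l"
      "(a, \<pi> ! k) \<in> A" "(b, \<pi> ! l) \<in> A" for k l a b
  proof (rule ccontr)
    assume "\<not> b \<le> a"
    have kl: "k < length \<pi>" "l < length \<pi>" using that len by auto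
    obtain \<rho> where \<rho>: "is_path (snd ` A) E \<rho>" "hd \<rho> = \<pi> ! k" "last \<rho> = \<pi> ! l"
        "length \<rho> = (if k \<le> l then l - k else k - l) + 1"
      using subpath[OF path kl] .
    have "length \<rho> < length \<pi>"
      using \<rho>(4) that(1-3) len r by (auto split: if_splits) 
    moreover have "inverted \<rho>"
      unfolding inverted_def using \<rho> that \<open>\<not> b \<le> a\<close> by auto
    ultimately show False using short by fastforce
  qed
  have "\<exists>c. (c, \<pi> ! k) \<in> A" if "k \<le> r" for k
  proof -
    have "\<pi> ! k \<in> set \<pi>" using that len by simp
    then have "\<pi> ! k \<in> snd ` A" using path unfolding is_path_def by blast
    then show ?thesis by force
  qed
  then obtain col where col: "\<And>k. k \<le> r \<Longrightarrow> (col k, \<pi> ! k) \<in> A" by metis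
  \<comment> \<open>the end colours are exchanged, so that the inversion turns into strict antitonicity\<close>
  define \<kappa> where "\<kappa> k = (if k = 0 then j else if k = r then i else col k)" for k
  have \<kappa>0: "\<kappa> 0 = j" and \<kappa>r: "\<kappa> r = i" using r by (auto simp: \<kappa>_def)
  have \<kappa>A: "(\<kappa> k, \<pi> ! k) \<in> A" if "0 < k" "k < r" for k
    using that col[of k] by (auto simp: \<kappa>_def)
  have below: "j \<le> \<kappa> k" if "0 < k" "k < r" "\<pi> ! k < last \<pi>" for k
    using sorted[of k r "\<kappa> k" j] that \<kappa>A jA last by (auto simp: doubleton_eq_iff)
  have above: "\<kappa> k \<le> i" if "0 < k" "k < r" "hd \<pi> < \<pi> ! k" for k
    using sorted[of 0 k i "\<kappa> k"] that \<kappa>A iA hd by (auto simp: doubleton_eq_iff)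
  have outside: "\<pi> ! k < hd \<pi> \<or> \<pi> ! k > last \<pi>" if "0 < k" "k < r" for k
  proof -
    have "\<pi> ! k \<noteq> hd \<pi>" "\<pi> ! k \<noteq> last \<pi>"
      using that dist len hd last by (auto simp: nth_eq_iff_index_eq)
    then show ?thesis using above[of k] below[of k] that ij by force
  qed
  have anti: "\<kappa> t \<le> \<kappa> s" if "s \<le> r" "t \<le> r" "\<pi> ! s < \<pi> ! t" for s t
  proof -
    have st: "s = 0 \<or> s = r \<or> 0 < s \<and> s < r" "t = 0 \<or> t = r \<or> 0 < t \<and> t < r"
      using that by linarith+
    show ?thesis
    proof (cases "0 < s \<and> s < r \<and> 0 < t \<and> t < r")
      case True
      then show ?thesis using sorted[of s t "\<kappa> s" "\<kappa> t"] \<kappa>A that by (auto simp: doubleton_eq_iff)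
    next
      case False
      then consider "s = 0" "t = 0 \<or> t = r" | "s = r" "t = 0 \<or> t = r"
        | "s = 0 \<or> s = r" "0 < t" "t < r" | "t = 0 \<or> t = r" "0 < s" "s < r"
        using st by blast
      then show ?thesis
      proof cases
        case 3
        then have "hd \<pi> < \<pi> ! t" using that xy hd last by auto
        then show ?thesis using 3 above[of t] ij \<kappa>0 \<kappa>r by auto
      next
        case 4
        then have "\<pi> ! s < last \<pi>" using that xy hd last by auto
        then show ?thesis using 4 below[of s] ij \<kappa>0 \<kappa>r by auto
      qed (use that xy ij \<kappa>0 \<kappa>r hd last in auto)
    qed
  qed
  have "admissible X E (hd \<pi>) (last \<pi>) \<pi>"
    unfolding admissible_def
  proof (intro conjI ballI allI impI)
    show "is_path X E \<pi>" using path assms(6) unfolding is_path_def by blast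
    show "\<pi> ! k < hd \<pi> \<or> last \<pi> < \<pi> ! k" if "k \<in> {1..<length \<pi> - 1}" for k
      using outside[of k] that r_def by auto
    show "\<not> is_path X E (hd \<pi> # ys @ [last \<pi>])"
      if ys: "distinct ys \<and> set ys \<subset> (\<lambda>k. \<pi> ! k) ` {1..<length \<pi> - 1}" for ys
    proof
      assume *: "is_path X E (hd \<pi> # ys @ [last \<pi>])"
      have sub: "(\<lambda>k. \<pi> ! k) ` {1..<length \<pi> - 1} \<subseteq> set \<pi>" by auto
      have "length ys = card (set ys)" using ys by (simp add: distinct_card)
      also have "\<dots> < card ((\<lambda>k. \<pi> ! k) ` {1..<length \<pi> - 1})"
        using ys by (intro psubset_card_mono) auto
      also have "\<dots> \<le> r - 1" using card_image_le[of "{1..<length \<pi> - 1}" "\<lambda>k. \<pi> ! k"] r_def by simp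
      finally have "length (hd \<pi> # ys @ [last \<pi>]) < length \<pi>" using len by simp
      moreover have "is_path (snd ` A) E (hd \<pi> # ys @ [last \<pi>])"
      proof -
        have "set ys \<subseteq> set \<pi>" using ys sub by blast
        then have "set (hd \<pi> # ys @ [last \<pi>]) \<subseteq> set \<pi>" using ne by auto
        then show ?thesis using * path unfolding is_path_def by blast
      qed
      then have "inverted (hd \<pi> # ys @ [last \<pi>])"
        unfolding inverted_def using xy ij iA jA by auto
      ultimately show False using short by fastforce
    qed
  qed (use dist xy in auto)
  moreover have "strictly_antitone_along \<pi> \<kappa>"
    unfolding strictly_antitone_along_def antitone_along_def
    using anti len ij \<kappa>0 \<kappa>r by (auto simp: less_Suc_eq_le)
  moreover have "leading_unknowns \<pi> \<kappa> \<subseteq> A"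
    unfolding leading_unknowns_def using \<kappa>A iA jA \<kappa>0 \<kappa>r len by auto
  ultimately show ?thesis using that by blast
qed

section \<open>Monomials of path binomials\<close>

text \<open>
  The graph of the colouring \<open>\<kappa>\<close> itself, split into ends and interior like \<open>leading_unknowns\<close>.
\<close>

definition trailing_unknowns :: "'x list \<Rightarrow> (nat \<Rightarrow> nat) \<Rightarrow> (nat \<times> 'x) set" where
  "trailing_unknowns \<pi> \<kappa> = insert (\<kappa> (length \<pi> - 1), last \<pi>) (insert (\<kappa> 0, hd \<pi>)
     ((\<lambda>k. (\<kappa> k, \<pi> ! k)) ` {1..<length \<pi> - 1}))"

lemma finite_leading_unknowns: "finite (leading_unknowns \<pi> \<kappa>)"
  and finite_trailing_unknowns: "finite (trailing_unknowns \<pi> \<kappa>)"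
  by (simp_all add: leading_unknowns_def trailing_unknowns_def)

definition path_binomial :: "'x list \<Rightarrow> (nat \<Rightarrow> nat) \<Rightarrow> (nat \<times> 'x, 'k::field) mpoly" where
  "path_binomial \<pi> \<kappa> =
     path_monomial \<pi> \<kappa> * edge_binomial (\<kappa> (length \<pi> - 1)) (\<kappa> 0) (hd \<pi>) (last \<pi>)"

lemma path_binomials_eq:
  fixes X :: "'x::linorder set"
  shows "(path_binomials d X E :: (nat \<times> 'x, 'k::field) mpoly set) =
    {path_binomial \<pi> \<kappa> | \<pi> \<kappa>. admissible X E (hd \<pi>) (last \<pi>) \<pi> \<and>
           \<kappa> \<in> {0..length \<pi> - 1} \<rightarrow> {1..d} \<and> strictly_antitone_along \<pi> \<kappa>}"
proof -
  have ends: "x \<in> X \<and> y \<in> X \<and> x < y \<and> x = hd \<pi> \<and> y = last \<pi>" if "admissible X E x y \<pi>" for \<pi> x y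
    using that unfolding admissible_def is_path_def by auto
  show ?thesis (is "_ = ?B")
  proof (intro equalityI subsetI)
    fix g :: "(nat \<times> 'x, 'k) mpoly"
    assume "g \<in> path_binomials d X E"
    then obtain \<pi> \<kappa> x y where
        "g = path_monomial \<pi> \<kappa> * edge_binomial (\<kappa> (length \<pi> - 1)) (\<kappa> 0) x y"
        "admissible X E x y \<pi>" "\<kappa> \<in> {0..length \<pi> - 1} \<rightarrow> {1..d}" "strictly_antitone_along \<pi> \<kappa>"
      unfolding path_binomials_def by blast
    moreover from this have "x = hd \<pi>" "y = last \<pi>" using ends by blast+
    ultimately show "g \<in> ?B" unfolding path_binomial_def by blast
  next
    fix g :: "(nat \<times> 'x, 'k) mpoly"
    assume "g \<in> ?B"
    then obtain \<pi> \<kappa> where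
        "g = path_monomial \<pi> \<kappa> * edge_binomial (\<kappa> (length \<pi> - 1)) (\<kappa> 0) (hd \<pi>) (last \<pi>)"
        "admissible X E (hd \<pi>) (last \<pi>) \<pi>" "\<kappa> \<in> {0..length \<pi> - 1} \<rightarrow> {1..d}"
        "strictly_antitone_along \<pi> \<kappa>"
      unfolding path_binomial_def by blast
    moreover from this have "hd \<pi> \<in> X" "last \<pi> \<in> X" "hd \<pi> < last \<pi>" using ends by blast+
    ultimately show "g \<in> path_binomials d X E" unfolding path_binomials_def by blast
  qed
qed

locale admissible_path =
  fixes X :: "'x::linorder set" and E :: "'x set set" and \<pi> :: "'x list" and \<kappa> :: "nat \<Rightarrow> nat"
  assumes admissible: "admissible X E (hd \<pi>) (last \<pi>) \<pi>"
    and antitone: "strictly_antitone_along \<pi> \<kappa>"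
begin

lemma hd_less_last: "hd \<pi> < last \<pi>"
  and distinct: "distinct \<pi>"
  and path: "is_path X E \<pi>"
  and colours: "\<kappa> (length \<pi> - 1) < \<kappa> 0"
  using admissible antitone unfolding admissible_def strictly_antitone_along_def by blast+

lemma length_path: "length \<pi> \<ge> 2" "\<pi> \<noteq> []"
proof -
  show "\<pi> \<noteq> []" using path by (simp add: is_path_def)
  moreover have "\<pi> \<noteq> [a]" for a using hd_less_last by auto
  ultimately show "length \<pi> \<ge> 2"
    by (metis One_nat_def Suc_1 Suc_leI Suc_lessI length_0_conv length_Suc_conv length_greater_0_conv)
qed

lemma hd_nth: "hd \<pi> = \<pi> ! 0" and last_nth: "last \<pi> = \<pi> ! (length \<pi> - 1)"
  using length_path by (simp_all add: hd_conv_nth last_conv_nth)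

lemma antitoneD: "s < length \<pi> \<Longrightarrow> t < length \<pi> \<Longrightarrow> \<pi> ! s < \<pi> ! t \<Longrightarrow> \<kappa> t \<le> \<kappa> s"
  using antitone unfolding strictly_antitone_along_def antitone_along_def by blast

lemma interior_index: "k \<in> {1..<length \<pi> - 1} \<Longrightarrow> k < length \<pi>"
  by auto

lemma interior_ne:
  assumes "k \<in> {1..<length \<pi> - 1}"
  shows "\<pi> ! k \<noteq> hd \<pi>" "\<pi> ! k \<noteq> last \<pi>"
  using assms interior_index[OF assms] length_path(2) nth_eq_iff_index_eq[OF distinct, of k 0]
    nth_eq_iff_index_eq[OF distinct, of k "length \<pi> - 1"]
  unfolding hd_nth last_nth by simp_all

lemma ends_not_interior:
  "(c, hd \<pi>) \<notin> (\<lambda>k. (\<kappa> k, \<pi> ! k)) ` {1..<length \<pi> - 1}"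
  "(c, last \<pi>) \<notin> (\<lambda>k. (\<kappa> k, \<pi> ! k)) ` {1..<length \<pi> - 1}"
  by (auto dest: interior_ne[THEN not_sym] simp del: One_nat_def)

text \<open>
  It is enough to compare an interior vertex with the nearer end: its colour is on the same side of
  the other end colour, because \<open>\<kappa>\<close> is strict at the ends.
\<close>

lemma interior_cases:
  assumes k: "k \<in> {1..<length \<pi> - 1}"
  obtains "\<pi> ! k < hd \<pi>" "\<kappa> 0 \<le> \<kappa> k" | "last \<pi> < \<pi> ! k" "\<kappa> k \<le> \<kappa> (length \<pi> - 1)"
proof -
  have "\<pi> ! k < hd \<pi> \<or> last \<pi> < \<pi> ! k" using admissible k unfolding admissible_def by blast
  then show ?thesis
  proof
    assume *: "\<pi> ! k < hd \<pi>"
    show ?thesis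
      by (rule that(1)[OF *]) (use * antitoneD[of k 0] interior_index[OF k] length_path(2) hd_nth in simp)
  next
    assume *: "last \<pi> < \<pi> ! k"
    show ?thesis
      by (rule that(2)[OF *]) (use * antitoneD[of "length \<pi> - 1" k] interior_index[OF k] length_path(2) last_nth in simp)
  qed
qed

lemma trailing_unknowns_eq: "trailing_unknowns \<pi> \<kappa> = (\<lambda>k. (\<kappa> k, \<pi> ! k)) ` {..<length \<pi>}"
proof -
  have "{..<length \<pi>} = insert (length \<pi> - 1) (insert 0 {1..<length \<pi> - 1})"
    using length_path by auto
  then show ?thesis unfolding trailing_unknowns_def hd_nth last_nth by (simp only: image_insert)
qed

lemma trailing_unknowns_sorted:
  assumes "(i, u) \<in> trailing_unknowns \<pi> \<kappa>" "(j, v) \<in> trailing_unknowns \<pi> \<kappa>" "u < v"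
  shows "j \<le> i"
  using assms antitoneD unfolding trailing_unknowns_eq by auto

text \<open>
  Interior vertices keep their colours beyond both end colours, hence exchanging the end colours
  creates no inversion that involves an interior vertex.
\<close>

lemma leading_unknowns_inversion:
  assumes "(i, u) \<in> leading_unknowns \<pi> \<kappa>" "(j, v) \<in> leading_unknowns \<pi> \<kappa>" "u < v" "i < j"
  shows "i = \<kappa> (length \<pi> - 1)" "u = hd \<pi>" "j = \<kappa> 0" "v = last \<pi>"
proof -
  have inner: "\<kappa> l \<le> \<kappa> k" if "k \<in> {1..<length \<pi> - 1}" "l \<in> {1..<length \<pi> - 1}" "\<pi> ! k < \<pi> ! l" for k l
    using that antitoneD by auto
  consider (a) "i = \<kappa> (length \<pi> - 1)" "u = hd \<pi>" | (b) "i = \<kappa> 0" "u = last \<pi>"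
    | (c) k where "k \<in> {1..<length \<pi> - 1}" "i = \<kappa> k" "u = \<pi> ! k"
    using assms(1) by (auto simp: leading_unknowns_def)
  note I = this
  consider (a) "j = \<kappa> (length \<pi> - 1)" "v = hd \<pi>" | (b) "j = \<kappa> 0" "v = last \<pi>"
    | (c) l where "l \<in> {1..<length \<pi> - 1}" "j = \<kappa> l" "v = \<pi> ! l"
    using assms(2) by (auto simp: leading_unknowns_def)
  note J = this
  have "(i = \<kappa> (length \<pi> - 1) \<and> u = hd \<pi>) \<and> (j = \<kappa> 0 \<and> v = last \<pi>)"
  proof (cases rule: I)
    case a
    show ?thesis
    proof (cases rule: J)
      case (c l)
      show ?thesis
        by (rule interior_cases[OF c(1)]) (use c a assms(3,4) hd_less_last in auto)
    qed (use a assms in auto)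
  next
    case b
    show ?thesis
    proof (cases rule: J)
      case (c l)
      show ?thesis
        by (rule interior_cases[OF c(1)]) (use c b assms(3,4) hd_less_last colours in auto)
    qed (use b assms hd_less_last in auto)
  next
    case (c k)
    show ?thesis
    proof (cases rule: J)
      case a
      show ?thesis
        by (rule interior_cases[OF c(1)]) (use a c assms(3,4) hd_less_last colours in auto)
    next
      case b
      show ?thesis
        by (rule interior_cases[OF c(1)]) (use b c assms(3,4) hd_less_last in auto)
    next
      case (c l)
      then show ?thesis using inner[of k l] \<open>k \<in> _\<close> \<open>i = _\<close> \<open>u = _\<close> assms(3,4) by auto
    qed
  qed
  then show "i = \<kappa> (length \<pi> - 1)" "u = hd \<pi>" "j = \<kappa> 0" "v = last \<pi>" by auto
qed

text \<open>
  The vertices of the path are distinct, so both monomials are squarefree and sets of unknowns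
  describe them completely.
\<close>

lemma path_binomial_eq:
  "path_binomial \<pi> \<kappa> =
     (Poly_Mapping.single (squarefree_monomial (leading_unknowns \<pi> \<kappa>)) 1 -
      Poly_Mapping.single (squarefree_monomial (trailing_unknowns \<pi> \<kappa>)) 1
        :: (nat \<times> 'x, 'k::field) mpoly)"
proof -
  let ?N = "(\<lambda>k. (\<kappa> k, \<pi> ! k)) ` {1..<length \<pi> - 1}"
  have "inj_on (\<lambda>k. (\<kappa> k, \<pi> ! k)) {1..<length \<pi> - 1}"
    using distinct by (auto simp: inj_on_def nth_eq_iff_index_eq)
  then have u: "path_monomial \<pi> \<kappa> = (\<Prod>v\<in>?N. var v :: (nat \<times> 'x, 'k) mpoly)"
    by (simp add: path_monomial_def prod.reindex)
  have "(\<Prod>v\<in>leading_unknowns \<pi> \<kappa>. var v :: (nat \<times> 'x, 'k) mpoly) =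
      path_monomial \<pi> \<kappa> * (var (\<kappa> (length \<pi> - 1), hd \<pi>) * var (\<kappa> 0, last \<pi>))"
    unfolding leading_unknowns_def u using ends_not_interior hd_less_last
    by (subst prod.insert; (subst prod.insert)?) auto
  moreover have "(\<Prod>v\<in>trailing_unknowns \<pi> \<kappa>. var v :: (nat \<times> 'x, 'k) mpoly) =
      path_monomial \<pi> \<kappa> * (var (\<kappa> (length \<pi> - 1), last \<pi>) * var (\<kappa> 0, hd \<pi>))"
    unfolding trailing_unknowns_def u using ends_not_interior hd_less_last
    by (subst prod.insert; (subst prod.insert)?) auto
  ultimately show ?thesis
    unfolding path_binomial_def edge_binomial_def
    by (simp add: right_diff_distrib finite_leading_unknowns finite_trailing_unknowns flip: prod_var)
qed

text \<open>
  The largest unknown involved at the ends is the larger colour on the larger vertex, and only the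
  leading monomial contains it.
\<close>

lemma trailing_less_leading:
  "lex_order (squarefree_monomial (trailing_unknowns \<pi> \<kappa>)) (squarefree_monomial (leading_unknowns \<pi> \<kappa>))"
  unfolding lex_less_def
proof (intro exI conjI allI impI)
  let ?v = "(\<kappa> 0, last \<pi>)"
  have "?v \<notin> trailing_unknowns \<pi> \<kappa>"
    unfolding trailing_unknowns_def using colours hd_less_last ends_not_interior(2)
    by (simp add: image_iff)
  moreover have "?v \<in> leading_unknowns \<pi> \<kappa>" by (simp add: leading_unknowns_def)
  ultimately show "Poly_Mapping.lookup (squarefree_monomial (trailing_unknowns \<pi> \<kappa>)) ?v <
      Poly_Mapping.lookup (squarefree_monomial (leading_unknowns \<pi> \<kappa>)) ?v"
    by (simp add: lookup_squarefree_monomial finite_leading_unknowns finite_trailing_unknowns)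
  fix w assume "unknown_less ?v w"
  then have "w \<noteq> (\<kappa> (length \<pi> - 1), hd \<pi>)" "w \<noteq> (\<kappa> 0, last \<pi>)"
      "w \<noteq> (\<kappa> (length \<pi> - 1), last \<pi>)" "w \<noteq> (\<kappa> 0, hd \<pi>)"
    using colours hd_less_last unfolding unknown_less_def by force+
  then have "w \<in> leading_unknowns \<pi> \<kappa> \<longleftrightarrow> w \<in> trailing_unknowns \<pi> \<kappa>"
    unfolding leading_unknowns_def trailing_unknowns_def by blast
  then show "Poly_Mapping.lookup (squarefree_monomial (trailing_unknowns \<pi> \<kappa>)) w =
      Poly_Mapping.lookup (squarefree_monomial (leading_unknowns \<pi> \<kappa>)) w"
    by (simp add: lookup_squarefree_monomial finite_leading_unknowns finite_trailing_unknowns)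
qed

lemmas path_binomial_leading_data =
  binomial_leading_data[OF trailing_less_leading, folded path_binomial_eq]

end

text \<open>
  The end points of \<open>\<pi>\<close> are an inversion of the larger set, so they are the end points of \<open>\<rho>\<close>, with
  the same colours. If \<open>\<pi>\<close> had fewer interior vertices, it would be a forbidden shortcut for \<open>\<rho>\<close>.
  The order in which the two paths visit their common interior may differ, but the binomial does not
  depend on it.
\<close>

lemma leading_unknowns_subset_imp_eq:
  fixes X :: "'x::linorder set"
  assumes \<pi>: "admissible_path X E \<pi> \<kappa>" and \<rho>: "admissible_path X E \<rho> \<mu>"
    and sub: "leading_unknowns \<pi> \<kappa> \<subseteq> leading_unknowns \<rho> \<mu>"
  shows "path_binomial \<pi> \<kappa> = (path_binomial \<rho> \<mu> :: (nat \<times> 'x, 'k::field) mpoly)"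
proof -
  interpret \<pi>: admissible_path X E \<pi> \<kappa> by fact
  interpret \<rho>: admissible_path X E \<rho> \<mu> by fact
  let ?I = "(\<lambda>k. (\<kappa> k, \<pi> ! k)) ` {1..<length \<pi> - 1}"
  let ?J = "(\<lambda>k. (\<mu> k, \<rho> ! k)) ` {1..<length \<rho> - 1}"
  have mem: "(\<kappa> (length \<pi> - 1), hd \<pi>) \<in> leading_unknowns \<rho> \<mu>" "(\<kappa> 0, last \<pi>) \<in> leading_unknowns \<rho> \<mu>"
    using sub by (auto simp: leading_unknowns_def)
  note ends = \<rho>.leading_unknowns_inversion[OF mem \<pi>.hd_less_last \<pi>.colours]
  have IJ: "?I \<subseteq> ?J"
  proof
    fix v assume v: "v \<in> ?I"
    then have "v \<in> leading_unknowns \<rho> \<mu>" using sub by (auto simp: leading_unknowns_def)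
    moreover have "snd v \<noteq> hd \<rho>" "snd v \<noteq> last \<rho>" using v \<pi>.interior_ne ends by auto
    ultimately show "v \<in> ?J" by (auto simp: leading_unknowns_def)
  qed
  have snds: "snd ` ?I = (\<lambda>k. \<pi> ! k) ` {1..<length \<pi> - 1}" "snd ` ?J = (\<lambda>k. \<rho> ! k) ` {1..<length \<rho> - 1}"
    by (auto simp: image_image)
  have "snd ` ?I = snd ` ?J"
  proof (rule ccontr)
    assume "snd ` ?I \<noteq> snd ` ?J"
    then have "snd ` ?I \<subset> snd ` ?J" using image_mono[OF IJ] by (rule psubsetI[rotated])
    then have "set (butlast (tl \<pi>)) \<subset> (\<lambda>k. \<rho> ! k) ` {1..<length \<rho> - 1}"
      by (simp only: snds interior_image_eq[OF \<pi>.length_path(2)])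
    moreover have "distinct (butlast (tl \<pi>))"
      using \<pi>.distinct by (simp add: distinct_butlast distinct_tl)
    ultimately have "\<not> is_path X E (hd \<rho> # butlast (tl \<pi>) @ [last \<rho>])"
      using \<rho>.admissible unfolding admissible_def by blast
    moreover have "hd \<rho> # butlast (tl \<pi>) @ [last \<rho>] = \<pi>"
    proof -
      obtain x \<pi>' where \<pi>': "\<pi> = x # \<pi>'" "\<pi>' \<noteq> []"
        using \<pi>.length_path by (cases \<pi>) fastforce+
      then show ?thesis using ends append_butlast_last_id[OF \<pi>'(2)] by simp
    qed
    ultimately show False using \<pi>.path by simp
  qed
  moreover have "inj_on snd ?J"
    using \<rho>.distinct by (auto simp: inj_on_def nth_eq_iff_index_eq)
  ultimately have "?I = ?J" using IJ by (metis inj_on_image_eq_iff order_refl)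
  then show ?thesis
    using ends unfolding \<pi>.path_binomial_eq \<rho>.path_binomial_eq
    by (simp add: leading_unknowns_def trailing_unknowns_def)
qed

text \<open>
  Infinitely many functions \<open>\<kappa>\<close> give the same binomial, as only the values at the positions of the
  path matter; lists of these values range over a finite set.
\<close>

lemma finite_path_binomials:
  assumes "graph_on X E"
  shows "finite (path_binomials d X E :: (nat \<times> 'x::linorder, 'k::field) mpoly set)"
proof -
  have X: "finite X" using assms by (simp add: graph_on_def)
  let ?P = "{\<pi>. set \<pi> \<subseteq> X \<and> length \<pi> \<le> card X}"
  let ?C = "{cs. set cs \<subseteq> {1..d} \<and> length cs \<le> card X}"
  have "path_binomial \<pi> \<kappa> \<in> (\<lambda>(\<pi>, cs). path_binomial \<pi> ((!) cs) :: (nat \<times> 'x, 'k) mpoly) ` (?P \<times> ?C)"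
    if a: "admissible X E (hd \<pi>) (last \<pi>) \<pi>" and \<kappa>: "\<kappa> \<in> {0..length \<pi> - 1} \<rightarrow> {1..d}" for \<pi> \<kappa>
  proof -
    have p: "set \<pi> \<subseteq> X" "distinct \<pi>" "\<pi> \<noteq> []" using a by (auto simp: admissible_def is_path_def)
    then have len: "length \<pi> \<le> card X" using X by (metis card_mono distinct_card)
    let ?cs = "map \<kappa> [0..<length \<pi>]"
    have nth: "?cs ! k = \<kappa> k" if "k < length \<pi>" for k using that by simp
    have "set ?cs \<subseteq> {1..d}"
    proof
      fix c assume "c \<in> set ?cs"
      then obtain k where "k < length \<pi>" "c = \<kappa> k" by auto
      then show "c \<in> {1..d}" using \<kappa> by (metis PiE atLeastAtMost_iff le0 Suc_pred' less_Suc_eq_le length_greater_0_conv p(3))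
    qed
    moreover have "path_monomial \<pi> ((!) ?cs) = (path_monomial \<pi> \<kappa> :: (nat \<times> 'x, 'k) mpoly)"
      unfolding path_monomial_def by (rule prod.cong) (auto simp: nth)
    then have "path_binomial \<pi> ((!) ?cs) = (path_binomial \<pi> \<kappa> :: (nat \<times> 'x, 'k) mpoly)"
      unfolding path_binomial_def using p(3) nth[of 0] nth[of "length \<pi> - 1"]
      by (simp del: map_nth nth_map)
    ultimately show ?thesis using p(1) len by (intro image_eqI[of _ _ "(\<pi>, ?cs)"]) auto
  qed
  then have "path_binomials d X E \<subseteq>
      (\<lambda>(\<pi>, cs). path_binomial \<pi> ((!) cs) :: (nat \<times> 'x, 'k) mpoly) ` (?P \<times> ?C)"
    unfolding path_binomials_eq by blast
  moreover have "finite (?P \<times> ?C)"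
    using finite_lists_length_le[OF X] finite_lists_length_le[of "{1..d}"] by blast
  ultimately show ?thesis using finite_subset by blast
qed

section \<open>Path binomials lie in the ideal\<close>

lemma path_monomial_Cons:
  assumes "length \<pi> \<ge> 2"
  shows "path_monomial (x # \<pi>) \<kappa> = var (\<kappa> 1, hd \<pi>) * path_monomial \<pi> (\<lambda>k. \<kappa> (Suc k))"
proof -
  obtain r where r: "length \<pi> = Suc (Suc r)" using assms by (metis add_2_eq_Suc le_Suc_ex)
  then have "\<pi> \<noteq> []" by auto
  have "path_monomial (x # \<pi>) \<kappa> = (\<Prod>k\<in>{Suc 0..<Suc (Suc r)}. var (\<kappa> k, (x # \<pi>) ! k))"
    using r by (simp add: path_monomial_def)
  also have "\<dots> = (\<Prod>k\<in>{0..<Suc r}. var (\<kappa> (Suc k), \<pi> ! k))"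
    by (subst prod.shift_bounds_Suc_ivl) simp
  also have "\<dots> = var (\<kappa> 1, \<pi> ! 0) * (\<Prod>k\<in>{Suc 0..<Suc r}. var (\<kappa> (Suc k), \<pi> ! k))"
    by (subst prod.atLeast_Suc_lessThan) auto
  finally show ?thesis using r \<open>\<pi> \<noteq> []\<close> by (simp add: path_monomial_def hd_conv_nth)
qed

lemma path_monomial_in_carrier:
  assumes "set \<pi> \<subseteq> X" "\<kappa> \<in> {0..length \<pi> - 1} \<rightarrow> {1..d}"
  shows "path_monomial \<pi> \<kappa> \<in> carrier (poly_ring (unknowns d X) :: (nat \<times> 'x, 'k::field) mpoly ring)"
proof -
  interpret ring "poly_ring (unknowns d X) :: (nat \<times> 'x, 'k) mpoly ring" by (rule ring_poly_ring)
  have "(\<Prod>k\<in>A. var (\<kappa> k, \<pi> ! k)) \<in> carrier (poly_ring (unknowns d X) :: (nat \<times> 'x, 'k) mpoly ring)"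
    if "finite A" "A \<subseteq> {1..<length \<pi> - 1}" for A
    using that
  proof (induction A rule: finite_induct)
    case empty
    then show ?case using one_closed by simp
  next
    case (insert k A)
    have "\<pi> ! k \<in> X" using insert assms(1) by (auto intro: subsetD[OF _ nth_mem])
    then have "var (\<kappa> k, \<pi> ! k) \<in> carrier (poly_ring (unknowns d X) :: (nat \<times> 'x, 'k) mpoly ring)"
      using insert assms(2) by (intro var_in_carrier) (auto simp: unknowns_def)
    then show ?case
      using insert m_closed[of "var (\<kappa> k, \<pi> ! k)" "\<Prod>k\<in>A. var (\<kappa> k, \<pi> ! k)"]
      by (simp del: poly_ring_simps(1))
  qed
  then show ?thesis by (simp add: path_monomial_def del: poly_ring_simps(1))
qed

text \<open>
  With \<open>z\<close> the second vertex, exchanging the end colours amounts to swapping along the edge \<open>x z\<close>,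
  exchanging the ends of the remaining path from \<open>z\<close> to \<open>y\<close>, and swapping along \<open>x z\<close> once more.
\<close>

lemma path_swap_in_ideal:
  assumes G: "graph_on X E" and "is_path X E \<pi>" "length \<pi> \<ge> 2"
    "\<kappa> \<in> {0..length \<pi> - 1} \<rightarrow> {1..d}" "i \<in> {1..d}" "j \<in> {1..d}"
  shows "(path_monomial \<pi> \<kappa> * edge_binomial i j (hd \<pi>) (last \<pi>) :: (nat \<times> 'x, 'k::field) mpoly)
    \<in> binomial_edge_ideal d X E"
  using assms(2-)
proof (induction \<pi> arbitrary: \<kappa> i j)
  case Nil
  then show ?case by simp
next
  case (Cons x \<pi>)
  let ?R = "poly_ring (unknowns d X) :: (nat \<times> 'x, 'k) mpoly ring"
  let ?I = "binomial_edge_ideal d X E :: (nat \<times> 'x, 'k) mpoly set"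
  interpret ideal ?I ?R by (rule ideal_binomial_edge_ideal[OF G])
  have add: "f + g \<in> ?I" if "f \<in> ?I" "g \<in> ?I" for f g
    using additive_subgroup.a_closed[OF is_additive_subgroup that] by simp
  have mult: "f * g \<in> ?I" if "f \<in> carrier ?R" "g \<in> ?I" for f g
    using I_l_closed[OF that(2,1)] by simp
  have mclosed: "f * g \<in> carrier ?R" if "f \<in> carrier ?R" "g \<in> carrier ?R" for f g
    using m_closed[OF that] by (simp del: poly_ring_simps(1))
  show ?case
  proof (cases "length \<pi> \<ge> 2")
    case False
    then obtain y where \<pi>: "\<pi> = [y]" using Cons.prems(2) by (cases \<pi>) (auto simp: Suc_le_eq)
    then have "{x, y} \<in> E" using Cons.prems(1) by (simp add: is_path_def)
    then show ?thesis
      using edge_binomial_in_ideal[OF G] Cons.prems by (simp add: \<pi> path_monomial_def)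
  next
    case True
    define z y c v where "z = hd \<pi>" and "y = last \<pi>" and "c = \<kappa> 1"
      and "v = (path_monomial \<pi> (\<lambda>k. \<kappa> (Suc k)) :: (nat \<times> 'x, 'k) mpoly)"
    have ne: "\<pi> \<noteq> []" using True by auto
    have path: "is_path X E \<pi>" and edge: "{x, z} \<in> E" and X: "x \<in> X" "y \<in> X"
      using Cons.prems(1) ne by (auto simp: is_path_def successively_Cons y_def z_def)
    have \<kappa>': "(\<lambda>k. \<kappa> (Suc k)) \<in> {0..length \<pi> - 1} \<rightarrow> {1..d}"
    proof (rule Pi_I)
      fix k assume "k \<in> {0..length \<pi> - 1}"
      then have "Suc k \<in> {0..length (x # \<pi>) - 1}" using ne by (cases \<pi>) auto
      then show "\<kappa> (Suc k) \<in> {1..d}" using Cons.prems(3) by blast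
    qed
    have c: "c \<in> {1..d}" using Cons.prems(3) ne by (auto simp: Pi_iff c_def Suc_le_eq)
    have v: "v \<in> carrier ?R"
      unfolding v_def using path \<kappa>' by (intro path_monomial_in_carrier) (auto simp: is_path_def)
    have vars: "var (k, w) \<in> carrier ?R" if "k \<in> {1..d}" "w \<in> X" for k w
      using that by (intro var_in_carrier) (auto simp: unknowns_def)
    have inner: "v * edge_binomial i j z y \<in> ?I"
      unfolding v_def z_def y_def using Cons.IH[OF path True \<kappa>'] Cons.prems by blast
    \<comment> \<open>one summand per exchange; the intermediate monomials cancel\<close>
    have "v * var (j, y) * edge_binomial i c x z + var (c, x) * (v * edge_binomial i j z y)
        + v * var (i, y) * edge_binomial c j x z \<in> ?I"
      using Cons.prems(4,5) c X v edge
      by (intro add mult inner edge_binomial_in_ideal[OF G] mclosed vars) auto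
    also have "v * var (j, y) * edge_binomial i c x z + var (c, x) * (v * edge_binomial i j z y)
        + v * var (i, y) * edge_binomial c j x z = var (c, z) * v * edge_binomial i j x y"
      by (simp add: edge_binomial_def algebra_simps)
    finally show ?thesis
      using ne by (simp add: path_monomial_Cons[OF True] c_def z_def y_def v_def)
  qed
qed

section \<open>The reduced Groebner basis\<close>

text \<open>
  The coefficient of the leading monomial must cancel against another monomial with the same swap
  invariants, and that monomial is smaller.
\<close>

lemma leading_monomial_divisible:
  fixes f :: "(nat \<times> 'x::linorder, 'k::field) mpoly"
  assumes G: "graph_on X E" and f: "f \<in> binomial_edge_ideal d X E" "f \<noteq> 0"
  obtains g :: "(nat \<times> 'x, 'k) mpoly" where "g \<in> path_binomials d X E"
    "monomial_dvd (leading_monomial lex_order g) (leading_monomial lex_order f)"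
proof -
  define m where "m = leading_monomial lex_order f"
  have m: "m \<in> Poly_Mapping.keys f" "\<And>n. n \<in> Poly_Mapping.keys f \<Longrightarrow> n \<noteq> m \<Longrightarrow> lex_order n m"
    unfolding m_def using leading_monomial_greatest[OF f(2)] by auto
  have "f \<in> carrier (poly_ring (unknowns d X))"
    using ideal.Icarr[OF ideal_binomial_edge_ideal[OF G] f(1)] .
  then have keys: "Poly_Mapping.keys m \<subseteq> unknowns d X" using m(1) by auto
  let ?K = "rearrangements d E m"
  have "\<exists>n\<in>Poly_Mapping.keys f \<inter> ?K. n \<noteq> m"
  proof (rule ccontr)
    assume "\<not> ?thesis"
    then have "class_sum ?K f = (\<Sum>n\<in>Poly_Mapping.keys f. if n = m then Poly_Mapping.lookup f m else 0)"
      unfolding class_sum_def by (intro sum.cong) (auto simp: rearrangements_def)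
    then have "class_sum ?K f = Poly_Mapping.lookup f m" using m(1) by simp
    then show False
      using binomial_edge_ideal_class_sum[OF G f(1) swap_closed_rearrangements] m(1)
      by (simp add: in_keys_iff)
  qed
  then obtain n where n: "n \<in> ?K" "lex_order n m" using m(2) by blast
  obtain i j x y where xy: "x < y" "i < j" "(x, y) \<in> (support_edges E m)\<^sup>*"
      "(i, x) \<in> Poly_Mapping.keys m" "(j, y) \<in> Poly_Mapping.keys m"
    using exists_inversion[OF keys n] .
  then have "x \<in> snd ` Poly_Mapping.keys m" by force
  then obtain \<pi>\<^sub>0 where "is_path (snd ` Poly_Mapping.keys m) E \<pi>\<^sub>0" "hd \<pi>\<^sub>0 = x" "last \<pi>\<^sub>0 = y"
    using rtrancl_support_edges_path[OF xy(3)] by blast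
  moreover have "snd ` Poly_Mapping.keys m \<subseteq> X" using keys by (auto simp: unknowns_def)
  ultimately obtain \<pi> \<kappa> where \<pi>: "admissible X E (hd \<pi>) (last \<pi>) \<pi>" "strictly_antitone_along \<pi> \<kappa>"
      "leading_unknowns \<pi> \<kappa> \<subseteq> Poly_Mapping.keys m"
    using exists_leading_unknowns_subset[of "Poly_Mapping.keys m" E \<pi>\<^sub>0 i j X] xy by metis
  interpret admissible_path X E \<pi> \<kappa> using \<pi> by unfold_locales
  have "\<kappa> k \<in> {1..d}" if "k \<le> length \<pi> - 1" for k
  proof -
    have "\<exists>w. (\<kappa> k, w) \<in> leading_unknowns \<pi> \<kappa>"
    proof (cases "k = 0 \<or> k = length \<pi> - 1")
      case True
      then show ?thesis by (auto simp: leading_unknowns_def)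
    next
      case False
      then have "k \<in> {1..<length \<pi> - 1}" using that by auto
      then show ?thesis unfolding leading_unknowns_def by blast
    qed
    then show ?thesis using \<pi>(3) keys by (auto simp: unknowns_def)
  qed
  then have "\<kappa> \<in> {0..length \<pi> - 1} \<rightarrow> {1..d}" by (intro Pi_I) (simp only: atLeastAtMost_iff)
  then have "path_binomial \<pi> \<kappa> \<in> path_binomials d X E"
    unfolding path_binomials_eq using \<pi> by blast
  moreover have "monomial_dvd (leading_monomial lex_order (path_binomial \<pi> \<kappa> :: (nat \<times> 'x, 'k) mpoly)) m"
    using \<pi>(3) by (simp add: path_binomial_leading_data squarefree_monomial_dvd_iff finite_leading_unknowns)
  ultimately show ?thesis unfolding m_def by (rule that)
qed

text \<open>
  Divisibility of leading monomials suffices when the leading coefficients of \<open>G\<close> are units, here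
  \<open>1\<close>: a leading term of \<open>I\<close> is then a multiple of one of \<open>G\<close> with the quotient monomial as factor.
\<close>

lemma groebner_basisI:
  fixes I G :: "(nat \<times> 'x::linorder, 'k::field) mpoly set"
  assumes I: "ideal I (poly_ring V)" and "finite G" "G \<subseteq> I"
    and lc: "\<And>g. g \<in> G \<Longrightarrow> g \<noteq> 0 \<and> leading_coeff lex_order g = 1"
    and dvd: "\<And>f. f \<in> I \<Longrightarrow> f \<noteq> 0 \<Longrightarrow>
      \<exists>g\<in>G. monomial_dvd (leading_monomial lex_order g) (leading_monomial lex_order f)"
  shows "groebner_basis V lex_order I G"
proof -
  let ?R = "poly_ring V :: (nat \<times> 'x, 'k) mpoly ring"
  interpret ring ?R by (rule ring_poly_ring)
  have lt: "leading_term lex_order f \<in> carrier ?R" if f: "f \<in> I - {0}" for f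
  proof -
    have "f \<in> carrier ?R" by (rule ideal.Icarr[OF I]) (use f in simp)
    moreover have "leading_monomial lex_order f \<in> Poly_Mapping.keys f"
      using f by (intro leading_monomial_greatest(1)) simp
    ultimately show ?thesis by (simp add: leading_term_def)
  qed
  have G: "G \<subseteq> I - {0}" using \<open>G \<subseteq> I\<close> lc by blast
  have carr: "leading_term lex_order ` (I - {0}) \<subseteq> carrier ?R"
    by (rule image_subsetI[OF lt])
  have "Idl\<^bsub>?R\<^esub> (leading_term lex_order ` G) \<subseteq> Idl\<^bsub>?R\<^esub> (leading_term lex_order ` (I - {0}))"
    by (rule subset_Idl_subset[OF carr image_mono[OF G]])
  moreover have "Idl\<^bsub>?R\<^esub> (leading_term lex_order ` (I - {0})) \<subseteq> Idl\<^bsub>?R\<^esub> (leading_term lex_order ` G)"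
  proof (rule genideal_minimal)
    have sub: "leading_term lex_order ` G \<subseteq> carrier ?R"
      by (rule subset_trans[OF image_mono[OF G] carr])
    show id: "ideal (Idl\<^bsub>?R\<^esub> (leading_term lex_order ` G)) ?R" by (rule genideal_ideal[OF sub])
    show "leading_term lex_order ` (I - {0}) \<subseteq> Idl\<^bsub>?R\<^esub> (leading_term lex_order ` G)"
    proof (rule image_subsetI)
      fix f assume f: "f \<in> I - {0}"
      obtain g k where g: "g \<in> G" "leading_monomial lex_order f = leading_monomial lex_order g + k"
        using dvd[of f] f by (auto simp: monomial_dvd_def)
      let ?t = "Poly_Mapping.single k (leading_coeff lex_order f)"
      have eq: "leading_term lex_order f = ?t * leading_term lex_order g"
        using lc[OF g(1)] g(2) by (simp add: leading_term_def mult_single add.commute)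
      have "leading_coeff lex_order f \<noteq> 0"
        using leading_monomial_greatest(1)[of f] f by (simp add: leading_coeff_def in_keys_iff)
      then have "?t \<in> carrier ?R"
        using lt[OF f] g(2) by (simp add: leading_term_def keys_add_monomial)
      moreover have "leading_term lex_order g \<in> Idl\<^bsub>?R\<^esub> (leading_term lex_order ` G)"
        using genideal_self[OF sub] g(1) by blast
      ultimately show "leading_term lex_order f \<in> Idl\<^bsub>?R\<^esub> (leading_term lex_order ` G)"
        using ideal.I_l_closed[OF id] eq by (metis poly_ring_simps(2))
    qed
  qed
  ultimately have "Idl\<^bsub>?R\<^esub> (leading_term lex_order ` G) =
      Idl\<^bsub>?R\<^esub> (leading_term lex_order ` (I - {0}))" by (rule subset_antisym)
  moreover have "0 \<notin> G" using lc by blast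
  ultimately show ?thesis
    using I \<open>finite G\<close> \<open>G \<subseteq> I\<close> by (simp add: groebner_basis_def)
qed

theorem theorem2:
  fixes d\<^sub>0 :: nat and X :: "'x::linorder set" and E :: "'x set set"
  assumes "d\<^sub>0 > 1"
    and "finite X"
    and "graph_on X E"
  shows "reduced_groebner_basis (unknowns d\<^sub>0 X) (lex_less unknown_less)
           (binomial_edge_ideal d\<^sub>0 X E :: (nat \<times> 'x, 'k::field) mpoly set)
           (path_binomials d\<^sub>0 X E)"
proof -
  note G = assms(3)
  let ?G = "path_binomials d\<^sub>0 X E :: (nat \<times> 'x, 'k) mpoly set"
  let ?I = "binomial_edge_ideal d\<^sub>0 X E :: (nat \<times> 'x, 'k) mpoly set"
  have elem: "\<exists>\<pi> \<kappa>. admissible_path X E \<pi> \<kappa> \<and> \<kappa> \<in> {0..length \<pi> - 1} \<rightarrow> {1..d\<^sub>0} \<and> g = path_binomial \<pi> \<kappa>"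
    if "g \<in> ?G" for g
  proof -
    obtain \<pi> \<kappa> where "admissible X E (hd \<pi>) (last \<pi>) \<pi>" "\<kappa> \<in> {0..length \<pi> - 1} \<rightarrow> {1..d\<^sub>0}"
        "strictly_antitone_along \<pi> \<kappa>" "g = path_binomial \<pi> \<kappa>"
      using \<open>g \<in> ?G\<close> unfolding path_binomials_eq by blast
    then show ?thesis unfolding admissible_path_def by blast
  qed
  have lc: "g \<noteq> 0 \<and> leading_coeff lex_order g = 1" if g: "g \<in> ?G" for g
  proof -
    obtain \<pi> \<kappa> where "admissible_path X E \<pi> \<kappa>" "g = path_binomial \<pi> \<kappa>"
      using elem[OF g] by blast
    then interpret admissible_path X E \<pi> \<kappa> by simp
    show ?thesis using path_binomial_leading_data[where ?'k = 'k] \<open>g = _\<close> by auto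
  qed
  have "?G \<subseteq> ?I"
  proof
    fix g assume "g \<in> ?G"
    then obtain \<pi> \<kappa> where a: "admissible_path X E \<pi> \<kappa>" and \<kappa>: "\<kappa> \<in> {0..length \<pi> - 1} \<rightarrow> {1..d\<^sub>0}"
        and g: "g = path_binomial \<pi> \<kappa>"
      using elem by blast
    interpret admissible_path X E \<pi> \<kappa> by fact
    show "g \<in> ?I"
      unfolding g path_binomial_def using path length_path \<kappa>
      by (intro path_swap_in_ideal[OF G]) auto
  qed
  then have gb: "groebner_basis (unknowns d\<^sub>0 X) lex_order ?I ?G"
    using leading_monomial_divisible[OF G] lc
    by (intro groebner_basisI ideal_binomial_edge_ideal[OF G] finite_path_binomials[OF G]) blast+
  \<comment> \<open>a trailing monomial of \<open>h\<close> has no inversion; divisibility of its leading monomial forces \<open>g = h\<close>\<close>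
  have reduced: "\<not> monomial_dvd (leading_monomial lex_order g) m"
    if gh: "g \<in> ?G" "h \<in> ?G - {g}" and m: "m \<in> Poly_Mapping.keys h" for g h m
  proof
    assume dvd: "monomial_dvd (leading_monomial lex_order g) m"
    obtain \<pi> \<kappa> where \<pi>: "admissible_path X E \<pi> \<kappa>" and g: "g = path_binomial \<pi> \<kappa>"
      using elem[OF gh(1)] by blast
    obtain \<rho> \<mu> where \<rho>: "admissible_path X E \<rho> \<mu>" and h: "h = path_binomial \<rho> \<mu>"
      using elem gh(2) by blast
    interpret \<pi>: admissible_path X E \<pi> \<kappa> by fact
    interpret \<rho>: admissible_path X E \<rho> \<mu> by fact
    have sub: "leading_unknowns \<pi> \<kappa> \<subseteq> Poly_Mapping.keys m"
      using dvd by (simp add: g \<pi>.path_binomial_leading_data squarefree_monomial_dvd_iff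
          finite_leading_unknowns)
    have "Poly_Mapping.keys m = leading_unknowns \<rho> \<mu> \<or> Poly_Mapping.keys m = trailing_unknowns \<rho> \<mu>"
      using m by (auto simp: h \<rho>.path_binomial_leading_data keys_squarefree_monomial
          finite_leading_unknowns finite_trailing_unknowns)
    then show False
    proof
      assume "Poly_Mapping.keys m = leading_unknowns \<rho> \<mu>"
      then have "g = h" using leading_unknowns_subset_imp_eq[OF \<pi> \<rho>] sub g h by simp
      then show False using gh(2) by simp
    next
      assume "Poly_Mapping.keys m = trailing_unknowns \<rho> \<mu>"
      then have "\<kappa> 0 \<le> \<kappa> (length \<pi> - 1)"
        using \<rho>.trailing_unknowns_sorted[OF _ _ \<pi>.hd_less_last] sub
        by (auto simp: leading_unknowns_def)
      then show False using \<pi>.colours by simp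
    qed
  qed
  show ?thesis
    unfolding reduced_groebner_basis_def
    by (intro conjI ballI gb reduced) (use lc in auto)
qed

end
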